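(* Let $p,n\ge1$, let $g\in\mathbb{C}[x_1,\dots,x_p]$ be a polynomial and let $f_1,\dots,f_n\in\mathbb{C}[x_1,\dots,x_p]$ be polynomials each of which satisfies Mahler's Hypothesis. Then the values at $s=0$ of the analytically continued zeta integrals satisfy $$\deg\Big(\prod_{j=1}^n f_j\Big)\cdot Z\Big(0;\prod_{j=1}^n f_j,\,g\Big)=\sum_{j=1}^n\deg(f_j)\cdot Z(0;f_j,g).$$
   Context: Mahler's Hypothesis for $f\in\mathbb{C}[x_1,\dots,x_p]$: $f$ is non-constant, $f(x)\neq0$ for all $x\in[0,\infty)^p$, and the top-degree homogeneous part $f_{\mathrm{top}}$ of $f$ satisfies $f_{\mathrm{top}}(x)\ne0$ for all $x\in[0,\infty)^p\setminus\{0\}$. If $f$ and $h$ satisfy it, so does $fh$. Here $\deg$ is the total degree. For $f$ satisfying Mahler's Hypothesis and any polynomial $g$, the zeta integral is $$Z(s;f,g):=\int_{[0,\infty)^p}g(x)f(x)^{-s}\,dx\qquad\big(\mathrm{Re}(s)>(\deg(g)+p)/\deg(f)\big),$$ where $f(x)^{-s}:=e^{-s\log f(x)}$ and $\log f$ is any continuous branch of the logarithm of $f$ on $[0,\infty)^p$ (values of the continuation at integers $s$ do not depend on the choice). By a known theorem of Mahler, the integral converges absolutely in that half-plane, extends to a meromorphic function of $s\in\mathbb{C}$, and is regular at all $s=0,-1,-2,\dots$; $Z(0;f,g)$ denotes the value at $s=0$ of this continuation. *)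

theory Defs
  imports
    "HOL-Library.Poly_Mapping"
    "HOL-Complex_Analysis.Complex_Analysis"
begin

text \<open>
  Complex polynomials in variables indexed by \<^typ>\<open>'p\<close>: finitely supported maps from monomials
  (exponent vectors) to coefficients. The ring structure is the convolution product of
  \<^theory>\<open>HOL-Library.Poly_Mapping\<close>.
\<close>

type_synonym 'p cpoly = "('p \<Rightarrow>\<^sub>0 nat) \<Rightarrow>\<^sub>0 complex"

definition monom_degree :: "('p \<Rightarrow>\<^sub>0 nat) \<Rightarrow> nat" where
  "monom_degree m = (\<Sum>i\<in>Poly_Mapping.keys m. Poly_Mapping.lookup m i)"

text \<open>The zero polynomial gets degree 0; all its zeta integrals vanish.\<close>

definition total_degree :: "'p cpoly \<Rightarrow> nat" where
  "total_degree f = Max (insert 0 (monom_degree ` Poly_Mapping.keys f))"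

definition eval_cpoly :: "'p::finite cpoly \<Rightarrow> real ^ 'p \<Rightarrow> complex" where
  "eval_cpoly f x = (\<Sum>m\<in>Poly_Mapping.keys f.
     Poly_Mapping.lookup f m * (\<Prod>i\<in>UNIV. complex_of_real (x $ i) ^ Poly_Mapping.lookup m i))"

definition top_part :: "'p cpoly \<Rightarrow> 'p cpoly" where
  "top_part f = (\<Sum>m | m \<in> Poly_Mapping.keys f \<and> monom_degree m = total_degree f.
     Poly_Mapping.single m (Poly_Mapping.lookup f m))"

definition orthant :: "(real ^ 'p::finite) set" where
  "orthant = {x. \<forall>i. 0 \<le> x $ i}"

definition mahler_hypothesis :: "'p::finite cpoly \<Rightarrow> bool" where
  "mahler_hypothesis f \<longleftrightarrow>
     (\<nexists>c. f = Poly_Mapping.single 0 c) \<and>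
     (\<forall>x\<in>orthant. eval_cpoly f x \<noteq> 0) \<and>
     (\<forall>x\<in>orthant - {0}. eval_cpoly (top_part f) x \<noteq> 0)"

definition is_log_branch :: "'p::finite cpoly \<Rightarrow> (real ^ 'p \<Rightarrow> complex) \<Rightarrow> bool" where
  "is_log_branch f L \<longleftrightarrow>
     continuous_on orthant L \<and> (\<forall>x\<in>orthant. exp (L x) = eval_cpoly f x)"

text \<open>
  Here \<open>L\<close> is the chosen branch of \<open>log f\<close>, so the integrand is \<open>g(x) f(x)\<^sup>-\<^sup>s\<close>.
\<close>

definition zeta_integral :: "(real ^ 'p::finite \<Rightarrow> complex) \<Rightarrow> 'p cpoly \<Rightarrow> complex \<Rightarrow> complex" where
  "zeta_integral L g s = (LINT x:orthant|lborel. eval_cpoly g x * exp (- s * L x))"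

text \<open>
  The meromorphic continuation of the zeta integral to the whole plane. Requiring
  \<^const>\<open>nicely_meromorphic_on\<close> (continuous at every regular point, value 0 at poles) makes it
  unique as a HOL function; at a regular point its value is the usual one.
\<close>

definition zeta :: "'p::finite cpoly \<Rightarrow> (real ^ 'p \<Rightarrow> complex) \<Rightarrow> 'p cpoly \<Rightarrow> complex \<Rightarrow> complex" where
  "zeta f L g = (THE F. F nicely_meromorphic_on UNIV \<and>
     (\<forall>s. Re s > real (total_degree g + CARD('p)) / real (total_degree f) \<longrightarrow>
          F s = zeta_integral L g s))"

end

theory Submission
  imports Defs
begin

unbundle no fps_syntax

text \<open>
  Let \<open>F = \<Prod> f\<^sub>j\<close>, \<open>D = deg F\<close>, and let \<open>E\<close> be the Euler operator. For a logarithm \<open>\<Lambda>\<close> with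
  \<open>E \<Lambda> = d - h\<^sub>\<Lambda> / F\<close> and \<open>E F = D F - h\<close>, where \<open>h\<close> and \<open>h\<^sub>\<Lambda>\<close> have degree less than \<open>D\<close>, consider
  \<open>I\<^sub>\<Lambda>(s; m, g) = \<integral> g F\<^sup>-\<^sup>m exp (- s \<Lambda>)\<close> for \<open>g\<close> homogeneous of degree \<open>k\<close>. Integrating the radial
  derivative of the integrand gives
  \<open>(s d - (k + p - m D)) I\<^sub>\<Lambda>(s; m, g) = m I\<^sub>\<Lambda>(s; m + 1, g h) + s I\<^sub>\<Lambda>(s; m + 1, g h\<^sub>\<Lambda>)\<close>.
  The weight \<open>k + p - m D\<close> drops at every step, so iteration continues the integral to the whole
  plane, and it shows inductively that \<open>s d I\<^sub>\<Lambda>(s; m, g)\<close> has at \<open>s = 0\<close> a limit \<open>R(m, g)\<close> which is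
  linear in \<open>g\<close> and does not depend on \<open>\<Lambda>\<close>. The case \<open>m = 0\<close> then reads
  \<open>d I\<^sub>\<Lambda>(0; 0, g) = - R(1, g h\<^sub>\<Lambda>) / (k + p)\<close>, which is linear in \<open>h\<^sub>\<Lambda>\<close>. The branches of \<open>log f\<^sub>j\<close>
  and \<open>log F\<close> satisfy the assumptions with \<open>h\<^sub>\<Lambda> = h\<^sub>j\<close> and \<open>h\<^sub>\<Lambda> = h = \<Sum> h\<^sub>j\<close>, respectively.
\<close>

subsection \<open>Integration over the orthant\<close>

text \<open>What is additive is the logarithmic Euler derivative: \<open>E F / F\<close> is the sum
  of the \<open>E f_j / f_j\<close>. Writing every fraction over the common denominator
  \<open>F\<close>, with \<open>h_j\<close> the Euler defect of \<open>f_j\<close> times the product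
  of the other factors, makes all the logarithms share one recursion with the same \<open>F\<close>
  and \<open>h\<close>. The limit \<open>R\<close> forgets the logarithm because
  \<open>h_\<Lambda>\<close> always comes with a factor \<open>s\<close>. Along a chain of recursion
  steps the denominator vanishes at \<open>s = 0\<close> only at weight 0, and after that step the
  weight is negative and the integrals converge. Hence every pole at 0 is at most simple, and a term
  with one more factor \<open>s\<close> leaves no trace in the limit. For \<open>m = 0\<close> the
  competing \<open>h\<close> term is absent, so \<open>h_\<Lambda>\<close> enters exactly once.
  Mahler's hypothesis enters through compactness: the homogenization of \<open>f\<close> has no zero
  on a closed simplex. This gives a lower bound for \<open>F\<close> of order \<open>D\<close> and
  shows that every branch of the logarithm is \<open>d\<close> times the logarithm of
  \<open>1 + coord_sum x\<close> up to a bounded error. Only derivatives along rays occur, so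
  integration by parts is replaced by differentiating a scaling identity and no boundary terms
  arise.\<close>

definition coord_sum :: "real ^ 'p::finite \<Rightarrow> real" where
  "coord_sum x = (\<Sum>i\<in>UNIV. x $ i)"

lemma coord_sum_scaleR [simp]: "coord_sum (r *\<^sub>R x) = r * coord_sum x"
  by (simp add: coord_sum_def sum_distrib_left)

lemma coord_sum_nonneg: "x \<in> orthant \<Longrightarrow> 0 \<le> coord_sum x"
  by (simp add: coord_sum_def orthant_def sum_nonneg)

lemma coord_le_coord_sum: "x \<in> orthant \<Longrightarrow> x $ i \<le> coord_sum x"
  unfolding coord_sum_def orthant_def by (rule member_le_sum) auto

lemma continuous_on_coord_sum [continuous_intros]:
  "continuous_on A h \<Longrightarrow> continuous_on A (\<lambda>x. coord_sum (h x))"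
  unfolding coord_sum_def by (intro continuous_intros)

lemma scaleR_orthant: "x \<in> orthant \<Longrightarrow> 0 \<le> r \<Longrightarrow> r *\<^sub>R x \<in> orthant"
  by (simp add: orthant_def)

lemma scaleR_orthant_iff: "0 < r \<Longrightarrow> r *\<^sub>R x \<in> orthant \<longleftrightarrow> x \<in> orthant"
  by (simp add: orthant_def zero_le_mult_iff)

lemma closed_orthant: "closed (orthant :: (real ^ 'p::finite) set)"
  unfolding orthant_def by (intro closed_Collect_all closed_Collect_le continuous_intros)

lemma convex_orthant: "convex (orthant :: (real ^ 'p::finite) set)"
  unfolding orthant_def convex_def by auto

lemma zero_in_orthant [simp]: "0 \<in> orthant"
  by (simp add: orthant_def)

lemma borel_orthant [measurable]: "orthant \<in> sets borel"
  by (simp add: closed_orthant)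

section \<open>Projective compactification of the orthant by a simplex\<close>

definition corner_simplex :: "(real ^ 'p::finite) set" where
  "corner_simplex = {x \<in> orthant. coord_sum x \<le> 1}"

lemma compact_corner_simplex: "compact (corner_simplex :: (real ^ 'p::finite) set)"
proof -
  have "closed (corner_simplex :: (real ^ 'p) set)"
  proof -
    have "closed {x :: real ^ 'p. coord_sum x \<le> 1}"
      by (intro closed_Collect_le continuous_intros)
    moreover have "corner_simplex = (orthant :: (real ^ 'p) set) \<inter> {x. coord_sum x \<le> 1}"
      by (auto simp: corner_simplex_def)
    ultimately show ?thesis using closed_Int[OF closed_orthant] by metis
  qed
  moreover have "bounded (corner_simplex :: (real ^ 'p) set)"
  proof -
    have "norm x \<le> 1" if "x \<in> corner_simplex" for x :: "real ^ 'p"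
    proof -
      have "norm x \<le> (\<Sum>i\<in>UNIV. \<bar>x $ i\<bar>)" by (rule norm_le_l1_cart)
      also have "\<dots> = coord_sum x"
        using that by (simp add: corner_simplex_def orthant_def coord_sum_def)
      also have "\<dots> \<le> 1" using that by (simp add: corner_simplex_def)
      finally show ?thesis .
    qed
    then show ?thesis unfolding bounded_iff by blast
  qed
  ultimately show ?thesis by (simp add: compact_eq_bounded_closed)
qed

lemma convex_corner_simplex: "convex (corner_simplex :: (real ^ 'p::finite) set)"
proof (rule convexI)
  fix x y :: "real ^ 'p" and u v :: real
  assume *: "x \<in> corner_simplex" "y \<in> corner_simplex" "0 \<le> u" "0 \<le> v" "u + v = 1"
  have "coord_sum (u *\<^sub>R x + v *\<^sub>R y) = u * coord_sum x + v * coord_sum y"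
    by (simp add: coord_sum_def sum.distrib sum_distrib_left)
  also have "\<dots> \<le> u * 1 + v * 1"
    using * by (intro add_mono mult_left_mono) (auto simp: corner_simplex_def)
  finally show "u *\<^sub>R x + v *\<^sub>R y \<in> corner_simplex"
    using * convex_orthant unfolding corner_simplex_def convex_def by auto
qed

text \<open>In projective terms the orthant becomes the part \<open>coord_sum y < 1\<close> of the
  simplex, and the face \<open>coord_sum y = 1\<close> lies at infinity. The coordinate sum takes
  the place of a norm because it is linear, so that homogenizing with it keeps polynomials
  polynomial.\<close>

definition compactify :: "real ^ 'p::finite \<Rightarrow> real ^ 'p" where
  "compactify x = (1 / (1 + coord_sum x)) *\<^sub>R x"

lemma compactify_in: "x \<in> orthant \<Longrightarrow> compactify x \<in> corner_simplex"
  using coord_sum_nonneg[of x]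
  by (auto simp: compactify_def corner_simplex_def intro!: scaleR_orthant)

lemma continuous_on_compactify: "continuous_on orthant compactify"
  unfolding compactify_def
  by (intro continuous_intros) (use coord_sum_nonneg in \<open>fastforce\<close>)

lemma compactify_scaleR: "x \<in> orthant \<Longrightarrow> (1 + coord_sum x) *\<^sub>R compactify x = x"
  using coord_sum_nonneg[of x] by (simp add: compactify_def)

lemma corner_simplex_subset: "corner_simplex \<subseteq> orthant"
  by (auto simp: corner_simplex_def)

lemma bounded_on_corner_simplex:
  fixes g :: "real ^ 'p::finite \<Rightarrow> complex"
  assumes "continuous_on corner_simplex g"
  obtains C where "C > 0" "\<And>x. x \<in> corner_simplex \<Longrightarrow> norm (g x) \<le> C"
proof -
  have "bounded (g ` corner_simplex)"
    by (intro compact_imp_bounded compact_continuous_image assms compact_corner_simplex)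
  then show thesis
    using that unfolding bounded_pos by auto
qed

lemma bounded_below_on_corner_simplex:
  fixes g :: "real ^ 'p::finite \<Rightarrow> complex"
  assumes "continuous_on corner_simplex g" "\<And>x. x \<in> corner_simplex \<Longrightarrow> g x \<noteq> 0"
  obtains c where "c > 0" "\<And>x. x \<in> corner_simplex \<Longrightarrow> c \<le> norm (g x)"
proof -
  have "continuous_on corner_simplex (\<lambda>x :: real ^ 'p. inverse (g x))"
    using assms by (intro continuous_intros) auto
  then obtain C where C: "C > 0" "\<And>x :: real ^ 'p. x \<in> corner_simplex \<Longrightarrow> norm (inverse (g x)) \<le> C"
    by (rule bounded_on_corner_simplex) blast
  show thesis
  proof (rule that[of "1 / C"])
    fix x :: "real ^ 'p" assume x: "x \<in> corner_simplex"
    have "1 / norm (g x) \<le> C" using C(2)[OF x] by (simp add: norm_inverse divide_inverse)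
    then show "1 / C \<le> norm (g x)" 
      using assms(2)[OF x] C(1) by (simp add: field_simps)
  qed (use C in auto)
qed

section \<open>Integrability of functions of power decay\<close>

lemma nn_integral_powr_finite:
  fixes a :: real
  assumes "a < -1"
  shows "(\<integral>\<^sup>+x. ennreal (indicator {0..} x * (1 + x) powr a) \<partial>lborel) < \<infinity>"
proof -
  have 1: "((\<lambda>x. (1 + x) powr (a+1) / (a+1)) has_real_derivative (1 + x) powr a) (at x)"
    if "0 \<le> x" for x
    using that assms by (auto intro!: derivative_eq_intros)
  have 2: "((\<lambda>x. (1 + x) powr (a+1) / (a+1)) \<longlongrightarrow> 0) at_top"
  proof -
    have "((\<lambda>x. (1 + x) powr (a+1)) \<longlongrightarrow> 0) at_top"
      using assms
      by (intro tendsto_neg_powr filterlim_tendsto_add_at_top[OF tendsto_const] filterlim_ident) auto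
    then show ?thesis by (rule tendsto_divide_zero)
  qed
  have "(\<integral>\<^sup>+x. ennreal ((1 + x) powr a) * indicator {0..} x \<partial>lborel)
      = ennreal (0 - (1 + 0) powr (a+1) / (a+1))"
    by (rule nn_integral_FTC_atLeast[OF _ 1 _ 2]) auto
  then have "(\<integral>\<^sup>+x. ennreal ((1 + x) powr a) * indicator {0..} x \<partial>lborel) < \<infinity>"
    by simp
  also have "(\<integral>\<^sup>+x. ennreal ((1 + x) powr a) * indicator {0..} x \<partial>lborel)
     = (\<integral>\<^sup>+x. ennreal (indicator {0..} x * (1 + x) powr a) \<partial>lborel)"
    by (intro nn_integral_cong) (auto simp: indicator_def)
  finally show ?thesis .
qed

text \<open>The exponent is shared equally among the coordinates, each receiving
  \<open>q / CARD('p) < -1\<close>. Since \<open>1 + coord_sum x\<close> is at least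
  \<open>1 + x $ i\<close> and the exponent is negative, a product of one-variable functions
  dominates, and Tonelli applies.\<close>

lemma set_integrable_powr:
  fixes q :: real
  assumes q: "q < - real CARD('p::finite)"
  shows "set_integrable lborel (orthant :: (real ^ 'p) set) (\<lambda>x. (1 + coord_sum x) powr q)"
proof -
  define a where "a = q / real CARD('p)"
  have a: "a < -1" using q unfolding a_def by (simp add: field_simps)
  define w where "w = (\<lambda>t::real. indicator {0..} t * (1 + t) powr a)"
  have w[measurable]: "w \<in> borel_measurable borel" unfolding w_def by measurable
  have le: "indicator orthant x *\<^sub>R (1 + coord_sum x) powr q \<le> (\<Prod>b\<in>Basis. w (x \<bullet> b))"
    for x :: "real ^ 'p"
  proof (cases "x \<in> orthant")
    case True
    have 0: "0 \<le> coord_sum x" using True by (rule coord_sum_nonneg)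
    have "(1 + coord_sum x) powr q = (\<Prod>i\<in>(UNIV::'p set). (1 + coord_sum x) powr a)"
      using 0 by (simp add: a_def powr_realpow[symmetric] powr_powr)
    also have "\<dots> \<le> (\<Prod>i\<in>UNIV. w (x $ i))"
    proof (rule prod_mono, safe)
      fix i
      have xi: "0 \<le> x $ i" using True by (simp add: orthant_def)
      show "(1 + coord_sum x) powr a \<le> w (x $ i)"
        using xi coord_le_coord_sum[OF True, of i] a
        by (auto simp: w_def intro!: powr_mono2')
    qed auto
    also have "\<dots> = (\<Prod>b\<in>Basis. w (x \<bullet> b))"
    proof -
      have B: "(Basis :: (real ^ 'p) set) = (\<lambda>i. axis i 1) ` UNIV"
        by (auto simp: Basis_vec_def)
      have I: "inj (\<lambda>i::'p. axis i (1::real))"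
        by (auto simp: inj_def axis_eq_axis)
      show ?thesis
        unfolding B by (subst prod.reindex[OF I]) (simp add: inner_axis)
    qed
    finally show ?thesis using True by simp
  next
    case False
    then show ?thesis by (auto simp: w_def intro!: prod_nonneg)
  qed
  have "(\<integral>\<^sup>+x. ennreal (norm (indicator (orthant :: (real ^ 'p) set) x *\<^sub>R (1 + coord_sum x) powr q)) \<partial>lborel)
      \<le> (\<integral>\<^sup>+x. (\<Prod>b\<in>Basis. ennreal (w (x \<bullet> b))) \<partial>(lborel :: (real ^ 'p) measure))"
  proof (rule nn_integral_mono)
    fix x :: "real ^ 'p"
    have "norm (indicator (orthant :: (real ^ 'p) set) x *\<^sub>R (1 + coord_sum x) powr q)
        \<le> (\<Prod>b\<in>Basis. w (x \<bullet> b))"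
      using le[of x] by (simp add: indicator_def)
    then show "ennreal (norm (indicator (orthant :: (real ^ 'p) set) x *\<^sub>R (1 + coord_sum x) powr q))
       \<le> (\<Prod>b\<in>Basis. ennreal (w (x \<bullet> b)))"
      by (subst prod_ennreal) (auto simp: w_def intro!: ennreal_leI)
  qed
  also have "\<dots> = (\<Prod>b\<in>(Basis :: (real ^ 'p) set). (\<integral>\<^sup>+t. ennreal (w t) \<partial>lborel))"
    by (subst nn_integral_lborel_prod) (auto simp: w_def)
  also have "\<dots> < \<infinity>"
  proof -
    have "(\<integral>\<^sup>+t. ennreal (w t) \<partial>lborel) < \<infinity>" 
      unfolding w_def by (rule nn_integral_powr_finite[OF a])
    then show ?thesis by (simp add: power_less_top_ennreal)
  qed
  finally have fin: "(\<integral>\<^sup>+x. ennreal (norm (indicator (orthant :: (real ^ 'p) set) x *\<^sub>R (1 + coord_sum x) powr q)) \<partial>lborel) < \<infinity>" .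
  have "continuous_on orthant (\<lambda>x :: real ^ 'p. (1 + coord_sum x) powr q)"
    by (intro continuous_intros) (use coord_sum_nonneg in fastforce)
  then have "(\<lambda>x. indicator (orthant :: (real ^ 'p) set) x *\<^sub>R (1 + coord_sum x) powr q) \<in> borel_measurable borel"
    by (intro borel_measurable_continuous_on_indicator) auto
  then show ?thesis
    unfolding set_integrable_def using fin by (intro integrableI_bounded) auto
qed

lemma set_integrable_growth:
  fixes u :: "real ^ 'p::finite \<Rightarrow> complex"
  assumes "continuous_on orthant u" and q: "q < - real CARD('p)"
    and le: "\<And>x. x \<in> orthant \<Longrightarrow> norm (u x) \<le> C * (1 + coord_sum x) powr q"
  shows "set_integrable lborel orthant u"
proof -
  have "set_integrable lborel (orthant :: (real ^ 'p) set) (\<lambda>x. C * (1 + coord_sum x) powr q)"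
    using set_integrable_powr[OF q] by simp
  then show ?thesis
    unfolding set_integrable_def
  proof (rule Bochner_Integration.integrable_bound)
    show "(\<lambda>x. indicator orthant x *\<^sub>R u x) \<in> borel_measurable lborel"
      using assms(1) by (simp add: borel_measurable_continuous_on_indicator)
    show "AE x in lborel. norm (indicator orthant x *\<^sub>R u x) 
        \<le> norm (indicator orthant x *\<^sub>R (C * (1 + coord_sum x) powr q))"
      using order.trans[OF le abs_ge_self] by (auto simp: indicator_def)
  qed
qed

section \<open>Scaling of integrals and its infinitesimal form\<close>

lemma set_integral_scaleR:
  fixes u :: "real ^ 'p::finite \<Rightarrow> complex"
  assumes u: "set_integrable lborel orthant u" and c: "c > 0"
  shows "(LINT x:orthant|lborel. u (c *\<^sub>R x)) = (LINT x:orthant|lborel. u x) / of_real c ^ CARD('p)"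
    and "set_integrable lborel orthant (\<lambda>x. u (c *\<^sub>R x))"
proof -
  define U where "U = (\<lambda>x. indicator orthant x *\<^sub>R u x)"
  have U: "integrable lborel U" using u by (simp add: set_integrable_def U_def)
  then have [measurable]: "U \<in> borel_measurable borel" by simp
  have Uc: "U (c *\<^sub>R x) = indicator orthant x *\<^sub>R u (c *\<^sub>R x)" for x
    by (simp add: U_def indicator_def scaleR_orthant_iff[OF c])
  have lb: "(lborel :: (real ^ 'p) measure)
      = density (distr lborel borel (\<lambda>x. 0 + c *\<^sub>R x)) (\<lambda>_. ennreal (c ^ CARD('p)))"
    using lborel_affine[of c "0 :: real ^ 'p"] c by simp
  have "integrable (density (distr lborel borel (\<lambda>x. 0 + c *\<^sub>R x)) (\<lambda>_. ennreal (c ^ CARD('p)))) U"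
    using U by (subst (asm) lb)
  then have "integrable lborel (\<lambda>x. c ^ CARD('p) *\<^sub>R U (c *\<^sub>R x))"
    using c by (subst (asm) integrable_density) (auto simp: integrable_distr_eq)
  then have "integrable lborel (\<lambda>x. (1 / c ^ CARD('p)) *\<^sub>R (c ^ CARD('p) *\<^sub>R U (c *\<^sub>R x)))"
    by (rule integrable_scaleR_right)
  then show "set_integrable lborel orthant (\<lambda>x. u (c *\<^sub>R x))"
    using c by (simp add: set_integrable_def Uc)
  have "integral\<^sup>L lborel U
     = integral\<^sup>L (density (distr lborel borel (\<lambda>x. 0 + c *\<^sub>R x)) (\<lambda>_. ennreal (c ^ CARD('p)))) U"
    by (subst lb) simp
  also have "\<dots> = (LINT x|lborel. c ^ CARD('p) *\<^sub>R U (c *\<^sub>R x))"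
    using c by (subst integral_density) (auto simp: integral_distr)
  also have "\<dots> = of_real c ^ CARD('p) * (LINT x|lborel. U (c *\<^sub>R x))"
    by (simp add: scaleR_conv_of_real)
  finally show "(LINT x:orthant|lborel. u (c *\<^sub>R x)) = (LINT x:orthant|lborel. u x) / of_real c ^ CARD('p)"
    using c by (simp add: set_lebesgue_integral_def Uc U_def[symmetric])
qed

lemma has_vector_derivative_difference_quotient:
  assumes "(f has_vector_derivative f') (at a)"
  shows "((\<lambda>t. (f t - f a) /\<^sub>R (t - a)) \<longlongrightarrow> f') (at a)"
proof -
  have lim: "((\<lambda>t. norm (f t - f a - (t - a) *\<^sub>R f') / norm (t - a)) \<longlongrightarrow> 0) (at a)"
    using assms by (simp add: has_vector_derivative_def has_derivative_iff_norm)
  have "norm (f t - f a - (t - a) *\<^sub>R f') / norm (t - a) = norm ((f t - f a) /\<^sub>R (t - a) - f')"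
    if "t \<noteq> a" for t
  proof -
    have "(f t - f a) /\<^sub>R (t - a) - f' = (f t - f a - (t - a) *\<^sub>R f') /\<^sub>R (t - a)"
      using that by (simp add: scaleR_diff_right)
    then show ?thesis by (simp add: divide_inverse)
  qed
  then have "((\<lambda>t. norm ((f t - f a) /\<^sub>R (t - a) - f')) \<longlongrightarrow> 0) (at a)"
    by (intro Lim_transform_eventually[OF lim]) (simp add: eventually_at_filter)
  then have "((\<lambda>t. (f t - f a) /\<^sub>R (t - a) - f') \<longlongrightarrow> 0) (at a)"
    by (rule tendsto_norm_zero_cancel)
  then show ?thesis by (simp add: LIM_zero_iff)
qed

text \<open>Differentiating \<open>\<integral>u(r x) dx = r\<^sup>-\<^sup>p \<integral>u(x) dx\<close> at \<open>r = 1\<close>.\<close>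

lemma integral_radial_derivative:
  fixes u v :: "real ^ 'p::finite \<Rightarrow> complex"
  assumes cu: "continuous_on orthant u" and cv: "continuous_on orthant v"
    and deriv: "\<And>x r. x \<in> orthant \<Longrightarrow> r > 0 \<Longrightarrow>
       ((\<lambda>r. u (r *\<^sub>R x)) has_vector_derivative v (r *\<^sub>R x) /\<^sub>R r) (at r)"
    and q: "q < - real CARD('p)"
    and ule: "\<And>x. x \<in> orthant \<Longrightarrow> norm (u x) \<le> Cu * (1 + coord_sum x) powr q"
    and vle: "\<And>x. x \<in> orthant \<Longrightarrow> norm (v x) \<le> Cv * (1 + coord_sum x) powr q"
  shows "(LINT x:orthant|lborel. v x) = - of_nat CARD('p) * (LINT x:orthant|lborel. u x)"
proof -
  have iu: "set_integrable lborel orthant u" by (rule set_integrable_growth[OF cu q ule])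
  have iv: "set_integrable lborel orthant v" by (rule set_integrable_growth[OF cv q vle])
  \<comment> \<open>The scales approach 1 from above: for \<open>t \<ge> 1\<close> the point
    \<open>t x\<close> has the larger coordinate sum, so the decaying bound at \<open>t x\<close> is
    dominated by its value at \<open>x\<close>. This supplies one majorant for all
    \<open>n\<close>.\<close>
  define r where "r n = 1 + 1 / real (Suc n)" for n
  have r1: "r n > 1" for n by (simp add: r_def)
  have rl: "r \<longlonglongrightarrow> 1"
    unfolding r_def using tendsto_add[OF tendsto_const LIMSEQ_inverse_real_of_nat] by (simp add: divide_inverse)
  have rat: "filterlim r (at 1) sequentially"
    unfolding filterlim_at using rl r1 by (auto simp: less_imp_neq[symmetric] intro!: always_eventually)
  define Q where "Q n x = (u (r n *\<^sub>R x) - u x) /\<^sub>R (r n - 1)" for n x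
  have Cv: "Cv \<ge> 0"
    using order.trans[OF norm_ge_zero vle[of 0]] by (simp add: coord_sum_def)
  have "(\<lambda>n. LINT x|lborel. indicator orthant x *\<^sub>R Q n x) \<longlonglongrightarrow> (LINT x|lborel. indicator orthant x *\<^sub>R v x)"
  proof (rule integral_dominated_convergence[where w = "\<lambda>x. indicator orthant x *\<^sub>R (Cv * (1 + coord_sum x) powr q)"])
    show "(\<lambda>x. indicator orthant x *\<^sub>R v x) \<in> borel_measurable lborel"
      using iv by (simp add: set_integrable_def)
    show "(\<lambda>x. indicator orthant x *\<^sub>R Q n x) \<in> borel_measurable lborel" for n
    proof -
      have "continuous_on orthant (\<lambda>x. u (r n *\<^sub>R x))"
        using r1[of n] by (intro continuous_on_compose2[OF cu] continuous_intros) (auto intro!: scaleR_orthant)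
      then have "continuous_on orthant (Q n)" unfolding Q_def by (intro continuous_intros cu)
      then show ?thesis by (simp add: borel_measurable_continuous_on_indicator)
    qed
    show "integrable lborel (\<lambda>x::real^'p. indicator orthant x *\<^sub>R (Cv * (1 + coord_sum x) powr q))"
      using set_integrable_powr[OF q] by (simp add: set_integrable_def mult.left_commute)
    show "AE x in lborel. (\<lambda>n. indicator orthant x *\<^sub>R Q n x) \<longlonglongrightarrow> indicator orthant x *\<^sub>R v x"
    proof (intro AE_I2)
      fix x :: "real ^ 'p"
      have "(\<lambda>n. Q n x) \<longlonglongrightarrow> v x" if x: "x \<in> orthant"
      proof -
        have "((\<lambda>r. u (r *\<^sub>R x)) has_vector_derivative v x) (at 1)"
          using deriv[OF x, of 1] by simp
        from has_vector_derivative_difference_quotient[OF this]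
        have "((\<lambda>r. (u (r *\<^sub>R x) - u x) /\<^sub>R (r - 1)) \<longlongrightarrow> v x) (at 1)" by simp
        from filterlim_compose[OF this rat] show ?thesis unfolding Q_def .
      qed
      then show "(\<lambda>n. indicator orthant x *\<^sub>R Q n x) \<longlonglongrightarrow> indicator orthant x *\<^sub>R v x"
        by (cases "x \<in> orthant") auto
    qed
    show "AE x in lborel. norm (indicator orthant x *\<^sub>R Q n x) \<le> indicator orthant x *\<^sub>R (Cv * (1 + coord_sum x) powr q)" for n
    proof (intro AE_I2)
      fix x :: "real ^ 'p"
      have "norm (Q n x) \<le> Cv * (1 + coord_sum x) powr q" if x: "x \<in> orthant"
      proof -
        \<comment> \<open>The mean value inequality along the ray turns the bound on the radial
          derivative into a bound on the difference quotient.\<close>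
        have "norm (u (r n *\<^sub>R x) - u (1 *\<^sub>R x)) \<le> (Cv * (1 + coord_sum x) powr q) * norm (r n - 1)"
        proof (rule differentiable_bound[where S = "{1..r n}" and f = "\<lambda>r. u (r *\<^sub>R x)"
                and f' = "\<lambda>t h. h *\<^sub>R (v (t *\<^sub>R x) /\<^sub>R t)"])
          fix t assume t: "t \<in> {1..r n}"
          then show "((\<lambda>r. u (r *\<^sub>R x)) has_derivative (\<lambda>h. h *\<^sub>R (v (t *\<^sub>R x) /\<^sub>R t))) (at t within {1..r n})"
            using deriv[OF x, of t] by (auto simp: has_vector_derivative_def intro: has_derivative_at_withinI)
          have s: "0 \<le> coord_sum x" by (rule coord_sum_nonneg[OF x])
          have "norm (v (t *\<^sub>R x)) \<le> Cv * (1 + coord_sum (t *\<^sub>R x)) powr q"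
            using t by (intro vle scaleR_orthant x) auto
          also have "\<dots> \<le> Cv * (1 + coord_sum x) powr q"
            using t s Cv q by (intro mult_left_mono powr_mono2') (auto simp: mult_le_cancel_right1)
          finally have v1: "norm (v (t *\<^sub>R x)) \<le> Cv * (1 + coord_sum x) powr q" .
          show "onorm (\<lambda>h. h *\<^sub>R (v (t *\<^sub>R x) /\<^sub>R t)) \<le> Cv * (1 + coord_sum x) powr q"
          proof (rule onorm_le)
            fix h :: real
            have "norm (h *\<^sub>R (v (t *\<^sub>R x) /\<^sub>R t)) = norm (v (t *\<^sub>R x)) / t * \<bar>h\<bar>"
              using t by (simp add: divide_inverse abs_mult)
            also have "\<dots> \<le> norm (v (t *\<^sub>R x)) * \<bar>h\<bar>"
            proof (intro mult_right_mono)
              have "norm (v (t *\<^sub>R x)) / t \<le> norm (v (t *\<^sub>R x)) / 1"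
                using t by (intro divide_left_mono) auto
              then show "norm (v (t *\<^sub>R x)) / t \<le> norm (v (t *\<^sub>R x))" by simp
            qed auto
            also have "\<dots> \<le> Cv * (1 + coord_sum x) powr q * \<bar>h\<bar>"
              using v1 by (intro mult_right_mono) auto
            finally show "norm (h *\<^sub>R (v (t *\<^sub>R x) /\<^sub>R t)) \<le> Cv * (1 + coord_sum x) powr q * norm h"
              by simp
          qed
        qed (use r1[of n] in auto)
        moreover have "norm (Q n x) = norm (u (r n *\<^sub>R x) - u (1 *\<^sub>R x)) / (r n - 1)"
          using r1[of n] by (simp add: Q_def divide_inverse)
        ultimately show ?thesis
          using r1[of n] by (simp add: divide_le_eq)
      qed
      then show "norm (indicator orthant x *\<^sub>R Q n x) \<le> indicator orthant x *\<^sub>R (Cv * (1 + coord_sum x) powr q)"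
        by (auto simp: indicator_def)
    qed
  qed
  then have lim1: "(\<lambda>n. LINT x:orthant|lborel. Q n x) \<longlonglongrightarrow> (LINT x:orthant|lborel. v x)"
    by (simp add: set_lebesgue_integral_def)
  define I where "I = (LINT x:orthant|lborel. u x)"
  \<comment> \<open>The scaling law evaluates the same sequence exactly, as a multiple of a
    difference quotient at 1 of \<open>t\<close> to the power \<open>- p\<close>. Comparing the two
    limits gives the claim.\<close>
  have Qint: "(LINT x:orthant|lborel. Q n x) = of_real ((inverse (r n) ^ CARD('p) - 1) / (r n - 1)) * I" for n
  proof -
    have r0: "r n > 0" using r1[of n] by simp
    have "(LINT x:orthant|lborel. Q n x) = ((LINT x:orthant|lborel. u (r n *\<^sub>R x)) - I) /\<^sub>R (r n - 1)"
      unfolding Q_def I_def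
      using set_integral_diff(2)[OF set_integral_scaleR(2)[OF iu r0] iu]
      by (simp add: set_integral_scaleR_right)
    also have "\<dots> = (I / of_real (r n) ^ CARD('p) - I) /\<^sub>R (r n - 1)"
      by (simp add: set_integral_scaleR(1)[OF iu r0] I_def)
    also have "\<dots> = of_real ((inverse (r n) ^ CARD('p) - 1) / (r n - 1)) * I"
      by (simp add: scaleR_conv_of_real divide_inverse algebra_simps flip: power_inverse)
    finally show ?thesis .
  qed
  have "((\<lambda>t::real. inverse t ^ CARD('p)) has_real_derivative - real CARD('p)) (at 1)"
    by (auto intro!: derivative_eq_intros)
  then have "((\<lambda>t. (inverse t ^ CARD('p) - 1) / (t - 1)) \<longlongrightarrow> - real CARD('p)) (at 1)"
    by (simp add: has_field_derivative_iff)
  from filterlim_compose[OF this rat]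
  have "(\<lambda>n. (inverse (r n) ^ CARD('p) - 1) / (r n - 1)) \<longlonglongrightarrow> - real CARD('p)" .
  then have "(\<lambda>n. of_real ((inverse (r n) ^ CARD('p) - 1) / (r n - 1)) * I) \<longlonglongrightarrow> of_real (- real CARD('p)) * I"
    by (intro tendsto_intros)
  then have "(\<lambda>n. LINT x:orthant|lborel. Q n x) \<longlonglongrightarrow> of_real (- real CARD('p)) * I"
    by (simp only: Qint)
  from LIMSEQ_unique[OF lim1 this] show ?thesis by (simp add: I_def)
qed

subsection \<open>Radial logarithmic data and the recursion\<close>

text \<open>A condition on functions rather than polynomials: the recursion looks along rays only,
  so continuity and positive scalings suffice. The zero function has every degree, so absent
  components need no exception.\<close>

definition homogeneous :: "nat \<Rightarrow> (real ^ 'p::finite \<Rightarrow> complex) \<Rightarrow> bool" where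
  "homogeneous k g \<longleftrightarrow> continuous_on orthant g \<and>
     (\<forall>x\<in>orthant. \<forall>r>0. g (r *\<^sub>R x) = of_real r ^ k * g x)"

lemma homogeneous_continuous: "homogeneous k g \<Longrightarrow> continuous_on orthant g"
  by (simp add: homogeneous_def)

lemma homogeneous_scaleR:
  "homogeneous k g \<Longrightarrow> x \<in> orthant \<Longrightarrow> r > 0 \<Longrightarrow> g (r *\<^sub>R x) = of_real r ^ k * g x"
  by (simp add: homogeneous_def)

lemma homogeneous_mult:
  "homogeneous k g \<Longrightarrow> homogeneous l h \<Longrightarrow> homogeneous (k + l) (\<lambda>x. g x * h x)"
  unfolding homogeneous_def by (auto intro!: continuous_intros simp: power_add)

lemma homogeneous_zero: "homogeneous k (\<lambda>x. 0)"
  unfolding homogeneous_def by simp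

lemma homogeneous_cmult: "homogeneous k g \<Longrightarrow> homogeneous k (\<lambda>x. c * g x)"
  unfolding homogeneous_def by (auto intro!: continuous_intros)

lemma homogeneous_sum:
  "(\<And>a. a \<in> A \<Longrightarrow> homogeneous k (g a)) \<Longrightarrow> homogeneous k (\<lambda>x. \<Sum>a\<in>A. g a x)"
  unfolding homogeneous_def by (auto intro!: continuous_intros simp: sum_distrib_left)

text \<open>Every \<open>x\<close> is \<open>1 + coord_sum x\<close> times a point of the compact
  simplex, where a continuous function is bounded. The shift by 1 lets this work at the origin
  too.\<close>

lemma homogeneous_bound:
  fixes g :: "real ^ 'p::finite \<Rightarrow> complex"
  assumes "homogeneous k g"
  obtains C where "C > 0" "\<And>x. x \<in> orthant \<Longrightarrow> norm (g x) \<le> C * (1 + coord_sum x) ^ k"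
proof -
  have "continuous_on corner_simplex g"
    using homogeneous_continuous[OF assms] corner_simplex_subset by (rule continuous_on_subset)
  then obtain C where C: "C > 0" "\<And>x. x \<in> corner_simplex \<Longrightarrow> norm (g x) \<le> C"
    by (rule bounded_on_corner_simplex) blast
  show thesis
  proof (rule that[OF C(1)])
    fix x :: "real ^ 'p" assume x: "x \<in> orthant"
    have s: "0 \<le> coord_sum x" using x by (rule coord_sum_nonneg)
    have "g x = g ((1 + coord_sum x) *\<^sub>R compactify x)" using x by (simp add: compactify_scaleR)
    also have "\<dots> = of_real (1 + coord_sum x) ^ k * g (compactify x)"
      using s compactify_in[OF x] corner_simplex_subset
      by (intro homogeneous_scaleR[OF assms]) auto
    finally have "norm (g x) = (1 + coord_sum x) ^ k * norm (g (compactify x))"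
      using s by (simp add: norm_mult norm_power del: of_real_add)
    also have "\<dots> \<le> (1 + coord_sum x) ^ k * C"
      using s C(2)[OF compactify_in[OF x]] by (intro mult_left_mono) auto
    finally show "norm (g x) \<le> C * (1 + coord_sum x) ^ k" by (simp add: mult.commute)
  qed
qed

text \<open>Euler's identity restricted to a ray, in the shape that
  \<open>integral_radial_derivative\<close> takes: a function of the point \<open>r x\<close>,
  divided by \<open>r\<close>.\<close>

lemma homogeneous_has_vector_derivative:
  fixes g :: "real ^ 'p::finite \<Rightarrow> complex"
  assumes "homogeneous k g" "x \<in> orthant" "r > 0"
  shows "((\<lambda>r. g (r *\<^sub>R x)) has_vector_derivative (of_nat k * g (r *\<^sub>R x)) /\<^sub>R r) (at r)"
proof -
  have "((\<lambda>r. of_real r ^ k * g x) has_vector_derivative (of_nat k * of_real r ^ (k - 1)) * g x) (at r)"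
    by (intro has_vector_derivative_mult_left has_vector_derivative_real_field)
       (auto intro!: derivative_eq_intros)
  also have "(of_nat k * of_real r ^ (k - 1)) * g x = (of_nat k * g (r *\<^sub>R x)) /\<^sub>R r"
    unfolding homogeneous_scaleR[OF assms] using assms(3)
    by (cases k) (auto simp: scaleR_conv_of_real)
  finally show ?thesis
    by (rule has_vector_derivative_transform_within_open[where S = "{0<..}"])
       (use assms in \<open>auto simp: homogeneous_scaleR[OF assms(1)]\<close>)
qed

lemma set_integral_sum:
  fixes u :: "'i \<Rightarrow> 'a \<Rightarrow> complex"
  assumes "\<And>i. i \<in> S \<Longrightarrow> set_integrable M A (u i)"
  shows "set_integrable M A (\<lambda>x. \<Sum>i\<in>S. u i x)"
    and "(LINT x:A|M. \<Sum>i\<in>S. u i x) = (\<Sum>i\<in>S. LINT x:A|M. u i x)"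
  using assms unfolding set_integrable_def set_lebesgue_integral_def scaleR_sum_right
  by (auto intro!: Bochner_Integration.integral_sum)

lemma has_vector_derivative_inverse_power:
  fixes f :: "real \<Rightarrow> complex"
  assumes "(f has_vector_derivative f') (at r)" "f r \<noteq> 0"
  shows "((\<lambda>r. inverse (f r) ^ m) has_vector_derivative - of_nat m * (f' / f r) * inverse (f r) ^ m) (at r)"
proof -
  have "((\<lambda>z. inverse z ^ m) has_field_derivative - of_nat m * inverse (f r) * inverse (f r) ^ m) (at (f r))"
  proof (cases m)
    case (Suc n)
    then show ?thesis
      using DERIV_power_Suc[OF DERIV_inverse[OF assms(2)], of n]
      by (simp add: algebra_simps)
  qed auto
  from field_vector_diff_chain_at[OF assms(1) this] show ?thesis
    by (simp add: o_def field_simps)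
qed

text \<open>The \<open>H i\<close> are the homogeneous components of the Euler defect of
  \<open>F\<close>; their degrees stay below \<open>D\<close>. This data is kept apart from any
  logarithm so that \<open>zeta_residue\<close>, defined from it alone, is literally the same
  constant for all branches that are compared later.\<close>

locale radial_base =
  fixes F :: "real ^ 'p::finite \<Rightarrow> complex" and D :: nat
    and H :: "nat \<Rightarrow> real ^ 'p \<Rightarrow> complex" and c0 :: real
  assumes contF: "continuous_on orthant F"
    and c0: "c0 > 0"
    and lower: "\<And>x. x \<in> orthant \<Longrightarrow> c0 * (1 + coord_sum x) ^ D \<le> norm (F x)"
    and homH: "\<And>i. i < D \<Longrightarrow> homogeneous i (H i)"
    and derivF: "\<And>x r. x \<in> orthant \<Longrightarrow> r > 0 \<Longrightarrow>
      ((\<lambda>r. F (r *\<^sub>R x)) has_vector_derivative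
         (of_nat D * F (r *\<^sub>R x) - (\<Sum>i<D. H i (r *\<^sub>R x))) /\<^sub>R r) (at r)"
begin

text \<open>The degree of divergence at \<open>s = 0\<close>: the integrand grows with exponent
  \<open>k - m D\<close>, and the volume contributes the dimension. It is an integer because its
  sign separates the convergent, the polar and the remaining case.\<close>

definition weight :: "nat \<Rightarrow> nat \<Rightarrow> int" where
  "weight m k = int k + int CARD('p) - int m * int D"

lemma F_nonzero: "x \<in> orthant \<Longrightarrow> F x \<noteq> 0"
  using lower[of x] coord_sum_nonneg[of x] c0
  by (metis add_pos_nonneg linorder_not_less mult_pos_pos norm_zero zero_less_one zero_less_power)

text \<open>The limit of \<open>s d I(s)\<close> at \<open>s = 0\<close>, in a form that does not mention the logarithm.
  The first argument is fuel; the value is meaningful only if it exceeds \<open>weight m k\<close>.\<close>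

primrec zeta_residue :: "nat \<Rightarrow> nat \<Rightarrow> nat \<Rightarrow> (real ^ 'p \<Rightarrow> complex) \<Rightarrow> complex" where
  "zeta_residue 0 m k g = 0"
| "zeta_residue (Suc N) m k g =
    (if weight m k < 0 then 0
     else if weight m k = 0
     then of_nat m * (\<Sum>i<D. LINT x:orthant|lborel. g x * H i x / F x ^ Suc m)
     else - of_nat m / of_int (weight m k) *
       (\<Sum>i<D. zeta_residue N (Suc m) (k + i) (\<lambda>x. g x * H i x)))"

end

text \<open>A factor is measured against the whole product: \<open>Lam\<close> grows with the degree
  \<open>d\<close> of the factor, but its radial derivative is written with the denominator
  \<open>F\<close> of degree \<open>D\<close>.\<close>

locale radial_log = radial_base F D H c0
  for F :: "real ^ 'p::finite \<Rightarrow> complex" and D :: nat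
    and H :: "nat \<Rightarrow> real ^ 'p \<Rightarrow> complex" and c0 :: real +
  fixes d :: nat and Lam :: "real ^ 'p \<Rightarrow> complex"
    and HL :: "nat \<Rightarrow> real ^ 'p \<Rightarrow> complex" and B :: real
  assumes d: "d > 0"
    and contLam: "continuous_on orthant Lam"
    and boundLam: "\<And>x. x \<in> orthant \<Longrightarrow> norm (Lam x - of_real (real d * ln (1 + coord_sum x))) \<le> B"
    and homHL: "\<And>i. i < D \<Longrightarrow> homogeneous i (HL i)"
    and derivLam: "\<And>x r. x \<in> orthant \<Longrightarrow> r > 0 \<Longrightarrow>
      ((\<lambda>r. Lam (r *\<^sub>R x)) has_vector_derivative
         (of_nat d - (\<Sum>i<D. HL i (r *\<^sub>R x)) / F (r *\<^sub>R x)) /\<^sub>R r) (at r)"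
begin

section \<open>Convergence, recursion and holomorphy in the half-plane\<close>

definition integrand :: "complex \<Rightarrow> nat \<Rightarrow> (real ^ 'p \<Rightarrow> complex) \<Rightarrow> real ^ 'p \<Rightarrow> complex" where
  "integrand s m g x = g x / F x ^ m * exp (- s * Lam x)"

definition zint :: "complex \<Rightarrow> nat \<Rightarrow> (real ^ 'p \<Rightarrow> complex) \<Rightarrow> complex" where
  "zint s m g = (LINT x:orthant|lborel. integrand s m g x)"

definition growth :: "complex \<Rightarrow> nat \<Rightarrow> nat \<Rightarrow> real" where
  "growth s m k = real k - real m * real D - real d * Re s"

lemma growth_less_iff: 
  "growth s m k < - real CARD('p) \<longleftrightarrow> real_of_int (weight m k) < Re s * real d"
  by (auto simp: growth_def weight_def algebra_simps)

lemma continuous_on_integrand: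
  "homogeneous k g \<Longrightarrow> continuous_on orthant (integrand s m g)"
  unfolding integrand_def
  by (intro continuous_intros contF contLam) (auto simp: F_nonzero homogeneous_def)

text \<open>The bound \<open>B\<close> controls the imaginary part of \<open>Lam\<close> as well as
  the deviation of its real part. For non-real \<open>s\<close> the argument of \<open>F\<close>
  therefore costs only the constant factor \<open>exp (norm s * B)\<close>.\<close>

lemma norm_exp_Lam:
  assumes x: "x \<in> orthant"
  shows "norm (exp (- s * Lam x)) \<le> exp (norm s * B) * (1 + coord_sum x) powr (- real d * Re s)"
proof -
  define l where "l = ln (1 + coord_sum x)"
  have s0: "0 \<le> coord_sum x" using x by (rule coord_sum_nonneg)
  have "\<bar>Re (s * (Lam x - of_real (real d * l)))\<bar> \<le> norm s * B"
    using abs_Re_le_cmod[of "s * (Lam x - of_real (real d * l))"] 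
      mult_left_mono[OF boundLam[OF x], of "norm s"]
    by (simp add: norm_mult l_def)
  moreover have "Re (s * (Lam x - of_real (real d * l))) = Re (s * Lam x) - real d * Re s * l"
    by (simp add: algebra_simps)
  ultimately have "- Re (s * Lam x) \<le> norm s * B + (- real d * Re s) * l"
    by (simp add: abs_le_iff)
  then have "exp (- Re (s * Lam x)) \<le> exp (norm s * B) * exp ((- real d * Re s) * l)"
    by (simp add: exp_add[symmetric])
  moreover have "norm (exp (- s * Lam x)) = exp (- Re (s * Lam x))"
    by (simp add: norm_exp_eq_Re)
  ultimately show ?thesis using s0 by (simp add: powr_def l_def)
qed

lemma norm_integrand_le:
  assumes g: "homogeneous k g"
  obtains C where "C > 0" "\<And>x s. x \<in> orthant \<Longrightarrow>
    norm (integrand s m g x) \<le> C * exp (norm s * B) * (1 + coord_sum x) powr growth s m k"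
proof -
  obtain C where C: "C > 0" "\<And>x. x \<in> orthant \<Longrightarrow> norm (g x) \<le> C * (1 + coord_sum x) ^ k"
    using homogeneous_bound[OF g] by blast
  show thesis
  proof (rule that[of "C / c0 ^ m"])
    fix x :: "real ^ 'p" and s assume x: "x \<in> orthant"
    define t where "t = 1 + coord_sum x"
    have t: "t \<ge> 1" using coord_sum_nonneg[OF x] by (simp add: t_def)
    have "norm (g x) / norm (F x) ^ m \<le> (C * t ^ k) / (c0 * t ^ D) ^ m"
      using C(1) C(2)[OF x] lower[OF x] t c0
      by (intro frac_le power_mono) (auto simp: t_def)
    also have "\<dots> = C / c0 ^ m * t powr (real k - real m * real D)"
      using t by (simp add: power_mult_distrib power_mult[symmetric] powr_diff powr_realpow[symmetric] powr_powr
          mult.commute flip: of_nat_mult)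
    finally have 1: "norm (g x / F x ^ m) \<le> C / c0 ^ m * t powr (real k - real m * real D)"
      by (simp add: norm_divide norm_power)
    have "norm (integrand s m g x) = norm (g x / F x ^ m) * norm (exp (- s * Lam x))"
      by (simp add: integrand_def norm_mult norm_divide)
    also have "\<dots> \<le> (C / c0 ^ m * t powr (real k - real m * real D)) * 
       (exp (norm s * B) * t powr (- real d * Re s))"
      using 1 norm_exp_Lam[OF x] C(1) c0 unfolding t_def by (intro mult_mono) auto
    also have "\<dots> = C / c0 ^ m * exp (norm s * B) * (t powr (real k - real m * real D) * t powr (- real d * Re s))"
      by simp
    also have "t powr (real k - real m * real D) * t powr (- real d * Re s) = t powr growth s m k"
      unfolding powr_add[symmetric] growth_def by simp
    finally show "norm (integrand s m g x) \<le> C / c0 ^ m * exp (norm s * B) * (1 + coord_sum x) powr growth s m k"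
      by (simp add: t_def)
  qed (use C c0 in auto)
qed

lemma set_integrable_integrand:
  assumes g: "homogeneous k g" and s: "real_of_int (weight m k) < Re s * real d"
  shows "set_integrable lborel orthant (integrand s m g)"
proof -
  obtain C where C: "\<And>x s. x \<in> orthant \<Longrightarrow>
    norm (integrand s m g x) \<le> C * exp (norm s * B) * (1 + coord_sum x) powr growth s m k"
    using norm_integrand_le[OF g] by blast
  show ?thesis
    by (rule set_integrable_growth[OF continuous_on_integrand[OF g] s[folded growth_less_iff] C])
qed

text \<open>Product rule on three factors: the leading Euler terms contribute \<open>k\<close>,
  \<open>- m D\<close> and \<open>- s d\<close> times the integrand itself, while the defects
  \<open>H\<close> and \<open>HL\<close> carry a further \<open>1 / F\<close> and so land in
  integrands of index \<open>Suc m\<close>.\<close>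

lemma integrand_radial_derivative:
  assumes g: "homogeneous k g" and x: "x \<in> orthant" and r: "r > 0"
  shows "((\<lambda>r. integrand s m g (r *\<^sub>R x)) has_vector_derivative
     ((of_nat k - of_nat m * of_nat D - s * of_nat d) * integrand s m g (r *\<^sub>R x) +
      (\<Sum>i<D. of_nat m * integrand s (Suc m) (\<lambda>x. g x * H i x) (r *\<^sub>R x) +
             s * integrand s (Suc m) (\<lambda>x. g x * HL i x) (r *\<^sub>R x))) /\<^sub>R r) (at r)"
proof -
  define y where "y = r *\<^sub>R x"
  have y: "y \<in> orthant" using x r by (simp add: y_def scaleR_orthant)
  have Fy: "F y \<noteq> 0" using F_nonzero[OF y] .
  have dF: "((\<lambda>r. inverse (F (r *\<^sub>R x)) ^ m) has_vector_derivative 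
     - of_nat m * (((of_nat D * F y - (\<Sum>i<D. H i y)) /\<^sub>R r) / F y) * inverse (F y) ^ m) (at r)"
    using has_vector_derivative_inverse_power[OF derivF[OF x r]] Fy by (simp add: y_def)
  have "((\<lambda>r. - s * Lam (r *\<^sub>R x)) has_vector_derivative 
      - s * ((of_nat d - (\<Sum>i<D. HL i y) / F y) /\<^sub>R r)) (at r)"
    unfolding y_def by (rule has_vector_derivative_mult_right[OF derivLam[OF x r]])
  from field_vector_diff_chain_at[OF this DERIV_exp]
  have dE: "((\<lambda>r. exp (- s * Lam (r *\<^sub>R x))) has_vector_derivative 
      - s * ((of_nat d - (\<Sum>i<D. HL i y) / F y) /\<^sub>R r) * exp (- s * Lam y)) (at r)"
    by (simp add: o_def y_def)
  have dg: "((\<lambda>r. g (r *\<^sub>R x)) has_vector_derivative (of_nat k * g y) /\<^sub>R r) (at r)"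
    unfolding y_def by (rule homogeneous_has_vector_derivative[OF g x r])
  have "((\<lambda>r. g (r *\<^sub>R x) * inverse (F (r *\<^sub>R x)) ^ m * exp (- s * Lam (r *\<^sub>R x))) has_vector_derivative
      (g y * inverse (F y) ^ m) * (- s * ((of_nat d - (\<Sum>i<D. HL i y) / F y) /\<^sub>R r) * exp (- s * Lam y)) +
      (g y * (- of_nat m * (((of_nat D * F y - (\<Sum>i<D. H i y)) /\<^sub>R r) / F y) * inverse (F y) ^ m)
        + ((of_nat k * g y) /\<^sub>R r) * inverse (F y) ^ m) * exp (- s * Lam y)) (at r)"
    using has_vector_derivative_mult[OF has_vector_derivative_mult[OF dg dF] dE] by (simp add: y_def)
  moreover have "(g y * inverse (F y) ^ m) * (- s * ((of_nat d - (\<Sum>i<D. HL i y) / F y) /\<^sub>R r) * exp (- s * Lam y)) +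
      (g y * (- of_nat m * (((of_nat D * F y - (\<Sum>i<D. H i y)) /\<^sub>R r) / F y) * inverse (F y) ^ m)
        + ((of_nat k * g y) /\<^sub>R r) * inverse (F y) ^ m) * exp (- s * Lam y)
     = ((of_nat k - of_nat m * of_nat D - s * of_nat d) * integrand s m g y +
      (\<Sum>i<D. of_nat m * integrand s (Suc m) (\<lambda>x. g x * H i x) y +
             s * integrand s (Suc m) (\<lambda>x. g x * HL i x) y)) /\<^sub>R r" (is "?l = ?r")
  proof -
    define a b e where "a = (\<Sum>i<D. H i y)" and "b = (\<Sum>i<D. HL i y)" and "e = exp (- s * Lam y)"
    have "(\<Sum>i<D. of_nat m * integrand s (Suc m) (\<lambda>x. g x * H i x) y +
             s * integrand s (Suc m) (\<lambda>x. g x * HL i x) y)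
       = (of_nat m * a + s * b) * (g y / F y ^ Suc m * e)"
      unfolding integrand_def a_def b_def sum.distrib
      by (simp add: sum_distrib_left sum_distrib_right sum_divide_distrib e_def algebra_simps)
    then have "?r = ((of_nat k - of_nat m * of_nat D - s * of_nat d) * (g y / F y ^ m * e) +
      (of_nat m * a + s * b) * (g y / F y ^ Suc m * e)) / of_real r"
      by (simp add: integrand_def scaleR_conv_of_real divide_inverse e_def mult.commute)
    also have "\<dots> = ?l"
      using Fy r unfolding a_def[symmetric] b_def[symmetric] e_def[symmetric]
      by (simp add: scaleR_conv_of_real field_simps)
    finally show ?thesis ..
  qed
  ultimately show ?thesis
    by (simp add: integrand_def divide_inverse power_inverse y_def)
qed

text \<open>A defect component gains at most \<open>D - 1\<close> in degree, and the extra factor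
  \<open>1 / F\<close> loses \<open>D\<close>. This loss of at least one drives the
  continuation.\<close>

lemma weight_step: "i < D \<Longrightarrow> weight (Suc m) (k + i) \<le> weight m k - 1"
  by (simp add: weight_def algebra_simps)

text \<open>The radial derivative is integrated over the orthant. The \<open>- p\<close> from the
  change of volume completes \<open>k - m D\<close> to the weight once the leading terms stand on
  the left.\<close>

lemma zint_recursion:
  assumes g: "homogeneous k g" and s: "real_of_int (weight m k) < Re s * real d"
  shows "(s * of_nat d - of_int (weight m k)) * zint s m g =
    (\<Sum>i<D. of_nat m * zint s (Suc m) (\<lambda>x. g x * H i x) + s * zint s (Suc m) (\<lambda>x. g x * HL i x))"
proof -
  let ?v = "\<lambda>x. (of_nat k - of_nat m * of_nat D - s * of_nat d) * integrand s m g x +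
      (\<Sum>i<D. of_nat m * integrand s (Suc m) (\<lambda>x. g x * H i x) x +
             s * integrand s (Suc m) (\<lambda>x. g x * HL i x) x)"
  define q where "q = growth s m k"
  have q: "q < - real CARD('p)" using s by (simp add: q_def growth_less_iff)
  have hH: "homogeneous (k + i) (\<lambda>x. g x * H i x)" if "i < D" for i
    by (rule homogeneous_mult[OF g homH[OF that]])
  have hHL: "homogeneous (k + i) (\<lambda>x. g x * HL i x)" if "i < D" for i
    by (rule homogeneous_mult[OF g homHL[OF that]])
  \<comment> \<open>One exponent \<open>q\<close> has to dominate all terms of the derivative. Those
    of index \<open>Suc m\<close> decay at least as fast as the integrand, since
    \<open>i < D\<close>.\<close>
  have bnd: "\<exists>C. \<forall>x\<in>orthant. norm (integrand s (Suc m) h x) \<le> C * (1 + coord_sum x) powr q"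
    if h: "homogeneous (k + i) h" and i: "i < D" for h i
  proof -
    obtain C where C: "C > 0" "\<And>x s. x \<in> orthant \<Longrightarrow>
      norm (integrand s (Suc m) h x) \<le> C * exp (norm s * B) * (1 + coord_sum x) powr growth s (Suc m) (k + i)"
      using norm_integrand_le[OF h] by blast
    have "growth s (Suc m) (k + i) \<le> q"
      using i by (simp add: growth_def q_def algebra_simps)
    then have "norm (integrand s (Suc m) h x) \<le> C * exp (norm s * B) * (1 + coord_sum x) powr q" 
      if "x \<in> orthant" for x
      using coord_sum_nonneg[OF that] C(1)
      by (intro order.trans[OF C(2)[OF that]] mult_left_mono powr_mono) auto
    then show ?thesis by blast
  qed
  have "\<forall>i\<in>{..<D}. \<exists>C. \<forall>x\<in>orthant. norm (integrand s (Suc m) (\<lambda>x. g x * H i x) x) \<le> C * (1 + coord_sum x) powr q"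
    using bnd hH by auto
  then obtain C1 where C1: "\<And>i x. i < D \<Longrightarrow> x \<in> orthant \<Longrightarrow>
      norm (integrand s (Suc m) (\<lambda>x. g x * H i x) x) \<le> C1 i * (1 + coord_sum x) powr q"
    by (auto simp: bchoice_iff)
  have "\<forall>i\<in>{..<D}. \<exists>C. \<forall>x\<in>orthant. norm (integrand s (Suc m) (\<lambda>x. g x * HL i x) x) \<le> C * (1 + coord_sum x) powr q"
    using bnd hHL by auto
  then obtain C2 where C2: "\<And>i x. i < D \<Longrightarrow> x \<in> orthant \<Longrightarrow>
      norm (integrand s (Suc m) (\<lambda>x. g x * HL i x) x) \<le> C2 i * (1 + coord_sum x) powr q"
    by (auto simp: bchoice_iff)
  obtain C where C: "\<And>x s. x \<in> orthant \<Longrightarrow>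
    norm (integrand s m g x) \<le> C * exp (norm s * B) * (1 + coord_sum x) powr growth s m k"
    using norm_integrand_le[OF g] by blast
  define C' where "C' = norm (of_nat k - of_nat m * of_nat D - s * of_nat d) * (C * exp (norm s * B))
     + (\<Sum>i<D. real m * C1 i + norm s * C2 i)"
  have "(LINT x:orthant|lborel. ?v x) = - of_nat CARD('p) * (LINT x:orthant|lborel. integrand s m g x)"
  proof (rule integral_radial_derivative[OF _ _ _ q])
    show "continuous_on orthant (integrand s m g)" by (rule continuous_on_integrand[OF g])
    show "continuous_on orthant ?v"
      by (intro continuous_intros continuous_on_integrand[OF g]
          continuous_on_integrand[OF hH] continuous_on_integrand[OF hHL]) auto
    show "((\<lambda>r. integrand s m g (r *\<^sub>R x)) has_vector_derivative ?v (r *\<^sub>R x) /\<^sub>R r) (at r)"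
      if "x \<in> orthant" "r > 0" for x r
      by (rule integrand_radial_derivative[OF g that])
    show "norm (integrand s m g x) \<le> (C * exp (norm s * B)) * (1 + coord_sum x) powr q" if "x \<in> orthant" for x
      using C[OF that] by (simp add: q_def)
    show "norm (?v x) \<le> C' * (1 + coord_sum x) powr q" if x: "x \<in> orthant" for x
    proof -
      let ?t = "(1 + coord_sum x) powr q"
      have "norm (?v x) \<le> norm (of_nat k - of_nat m * of_nat D - s * of_nat d) * norm (integrand s m g x) +
        (\<Sum>i<D. real m * norm (integrand s (Suc m) (\<lambda>x. g x * H i x) x) +
             norm s * norm (integrand s (Suc m) (\<lambda>x. g x * HL i x) x))"
        by (intro order.trans[OF norm_triangle_ineq] add_mono order.trans[OF norm_sum] sum_mono)
           (auto simp: norm_mult)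
      also have "\<dots> \<le> norm (of_nat k - of_nat m * of_nat D - s * of_nat d) * (C * exp (norm s * B) * ?t) +
        (\<Sum>i<D. real m * (C1 i * ?t) + norm s * (C2 i * ?t))"
        using C[OF x, of s] C1[OF _ x] C2[OF _ x]
        by (intro add_mono mult_left_mono sum_mono) (auto simp: q_def)
      also have "\<dots> = C' * ?t"
        by (simp add: C'_def algebra_simps sum.distrib sum_distrib_left sum_distrib_right)
      finally show ?thesis .
    qed
  qed
  moreover have "(LINT x:orthant|lborel. ?v x) = 
     (of_nat k - of_nat m * of_nat D - s * of_nat d) * zint s m g +
    (\<Sum>i<D. of_nat m * zint s (Suc m) (\<lambda>x. g x * H i x) + s * zint s (Suc m) (\<lambda>x. g x * HL i x))"
  proof -
    have conv: "real_of_int (weight (Suc m) (k + i)) < Re s * real d" if "i < D" for i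
      using weight_step[OF that, of m k] s by linarith
    note i0 = set_integrable_integrand[OF g s]
    note iH = set_integrable_integrand[OF hH conv]
    note iHL = set_integrable_integrand[OF hHL conv]
    have i1: "set_integrable lborel orthant (\<lambda>x. of_nat m * integrand s (Suc m) (\<lambda>x. g x * H i x) x +
             s * integrand s (Suc m) (\<lambda>x. g x * HL i x) x)" if "i < D" for i
      using iH[OF that that] iHL[OF that that] by (intro set_integral_add) auto
    have "(LINT x:orthant|lborel. ?v x) = (LINT x:orthant|lborel. (of_nat k - of_nat m * of_nat D - s * of_nat d) * integrand s m g x)
       + (LINT x:orthant|lborel. (\<Sum>i<D. of_nat m * integrand s (Suc m) (\<lambda>x. g x * H i x) x +
             s * integrand s (Suc m) (\<lambda>x. g x * HL i x) x))"
    proof (rule set_integral_add(2))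
      show "set_integrable lborel orthant (\<lambda>x. (of_nat k - of_nat m * of_nat D - s * of_nat d) * integrand s m g x)"
        using i0 by simp
      show "set_integrable lborel orthant (\<lambda>x. \<Sum>i<D. of_nat m * integrand s (Suc m) (\<lambda>x. g x * H i x) x +
             s * integrand s (Suc m) (\<lambda>x. g x * HL i x) x)"
        using i1 by (intro set_integral_sum(1)) auto
    qed
    also have "(LINT x:orthant|lborel. (\<Sum>i<D. of_nat m * integrand s (Suc m) (\<lambda>x. g x * H i x) x +
             s * integrand s (Suc m) (\<lambda>x. g x * HL i x) x))
       = (\<Sum>i<D. LINT x:orthant|lborel. of_nat m * integrand s (Suc m) (\<lambda>x. g x * H i x) x +
             s * integrand s (Suc m) (\<lambda>x. g x * HL i x) x)"
      using i1 by (intro set_integral_sum) auto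
    also have "\<dots> = (\<Sum>i<D. of_nat m * zint s (Suc m) (\<lambda>x. g x * H i x) + s * zint s (Suc m) (\<lambda>x. g x * HL i x))"
    proof (intro sum.cong refl)
      fix i assume "i \<in> {..<D}"
      then have i: "i < D" by simp
      show "(LINT x:orthant|lborel. of_nat m * integrand s (Suc m) (\<lambda>x. g x * H i x) x +
             s * integrand s (Suc m) (\<lambda>x. g x * HL i x) x) =
         of_nat m * zint s (Suc m) (\<lambda>x. g x * H i x) + s * zint s (Suc m) (\<lambda>x. g x * HL i x)"
        using iH[OF i i] iHL[OF i i] unfolding zint_def
        by (subst set_integral_add) auto
    qed
    finally show ?thesis unfolding zint_def by simp
  qed
  ultimately have "(of_nat k - of_nat m * of_nat D - s * of_nat d) * zint s m g +
    (\<Sum>i<D. of_nat m * zint s (Suc m) (\<lambda>x. g x * H i x) + s * zint s (Suc m) (\<lambda>x. g x * HL i x)) 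
    = - of_nat CARD('p) * zint s m g"
    by (simp add: zint_def)
  then have "(\<Sum>i<D. of_nat m * zint s (Suc m) (\<lambda>x. g x * H i x) + s * zint s (Suc m) (\<lambda>x. g x * HL i x)) 
    = - of_nat CARD('p) * zint s m g - (of_nat k - of_nat m * of_nat D - s * of_nat d) * zint s m g"
    by (simp add: algebra_simps)
  then show ?thesis by (simp add: weight_def algebra_simps)
qed

text \<open>Differentiation under the integral sign. The derivative brings down
  \<open>- Lam x\<close>, which grows only logarithmically and is absorbed by the room that the
  strict inequality on \<open>Re s\<close> leaves.\<close>

lemma zint_holomorphic:
  assumes g: "homogeneous k g"
  shows "(\<lambda>s. zint s m g) holomorphic_on {s. real_of_int (weight m k) < Re s * real d}"
proof (rule holomorphic_onI)
  fix s0 assume "s0 \<in> {s. real_of_int (weight m k) < Re s * real d}"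
  then have s0: "real_of_int (weight m k) < Re s0 * real d" by simp
  define q where "q = growth s0 m k"
  have q: "q < - real CARD('p)" using s0 by (simp add: q_def growth_less_iff)
  \<comment> \<open>Half of the gap between \<open>q\<close> and \<open>- p\<close> is spent as
    \<open>2 * \<delta> * d\<close>: one \<open>\<delta>\<close> pays for moving \<open>s\<close>
    within the ball, the other for absorbing the factor \<open>norm (Lam x)\<close> into an
    exponential.\<close>
  define \<delta> where "\<delta> = (- real CARD('p) - q) / (4 * real d)"
  have \<delta>: "\<delta> > 0" using q d by (simp add: \<delta>_def)
  have q2: "q + 2 * \<delta> * real d < - real CARD('p)"
  proof -
    have "2 * \<delta> * real d = (- real CARD('p) - q) / 2" using d by (simp add: \<delta>_def)
    then show ?thesis using q by (simp add: field_simps)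
  qed
  obtain C where C: "C > 0" "\<And>x s. x \<in> orthant \<Longrightarrow>
    norm (integrand s m g x) \<le> C * exp (norm s * B) * (1 + coord_sum x) powr growth s m k"
    using norm_integrand_le[OF g] by blast
  define W where "W x = C * exp (norm s0 * B) / \<delta> * exp (2 * \<delta> * B) * (1 + coord_sum x) powr (q + 2 * \<delta> * real d)"
    for x :: "real ^ 'p"
  have key: "norm ((integrand s m g x - integrand s0 m g x) / (s - s0)) \<le> W x"
    if x: "x \<in> orthant" and s: "s \<in> ball s0 \<delta> - {s0}" for s x
  proof -
    define h where "h = s - s0"
    define l where "l = norm (Lam x)"
    have h: "h \<noteq> 0" "norm h < \<delta>" using s by (auto simp: h_def dist_norm norm_minus_commute)
    have c: "0 \<le> coord_sum x" by (rule coord_sum_nonneg[OF x])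
    have lle: "l \<le> real d * ln (1 + coord_sum x) + B"
    proof -
      have "l \<le> norm (complex_of_real (real d * ln (1 + coord_sum x))) + norm (Lam x - of_real (real d * ln (1 + coord_sum x)))"
        unfolding l_def by norm
      also have "\<dots> \<le> \<bar>real d * ln (1 + coord_sum x)\<bar> + B"
        using boundLam[OF x] by (simp only: norm_of_real)
      finally show ?thesis using c by simp
    qed
    have "integrand s m g x - integrand s0 m g x = integrand s0 m g x * (exp (- h * Lam x) - 1)"
    proof -
      have "- s * Lam x = - s0 * Lam x + - h * Lam x" by (simp add: h_def algebra_simps)
      then have "exp (- s * Lam x) = exp (- s0 * Lam x) * exp (- h * Lam x)"
        by (simp only: exp_add)
      then show ?thesis unfolding integrand_def by (simp only: right_diff_distrib mult.assoc mult_1_right)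
    qed
    then have "norm ((integrand s m g x - integrand s0 m g x) / (s - s0))
      = norm (integrand s0 m g x) * (norm (exp (- h * Lam x) - 1) / norm h)"
      by (simp add: h_def norm_mult norm_divide)
    also have "\<dots> \<le> (C * exp (norm s0 * B) * (1 + coord_sum x) powr q) * 
        ((1 / \<delta>) * (exp (2 * \<delta> * B) * (1 + coord_sum x) powr (2 * \<delta> * real d)))"
    proof (intro mult_mono)
      show "norm (integrand s0 m g x) \<le> C * exp (norm s0 * B) * (1 + coord_sum x) powr q"
        using C(2)[OF x] by (simp add: q_def)
      have "norm (exp (- h * Lam x) - 1) \<le> exp \<bar>Re (- h * Lam x)\<bar> * norm (- h * Lam x)"
        using Taylor_exp[of "- h * Lam x" 0] by simp
      also have "\<dots> \<le> exp (\<delta> * l) * (norm h * l)"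
      proof (intro mult_mono)
        have "\<bar>Re (- h * Lam x)\<bar> \<le> norm h * l"
          using abs_Re_le_cmod[of "- h * Lam x"] by (simp add: norm_mult l_def)
        also have "\<dots> \<le> \<delta> * l" using h by (intro mult_right_mono) (auto simp: l_def)
        finally show "exp \<bar>Re (- h * Lam x)\<bar> \<le> exp (\<delta> * l)" by simp
      qed (auto simp: norm_mult l_def)
      finally have "norm (exp (- h * Lam x) - 1) / norm h \<le> exp (\<delta> * l) * l"
        using h by (simp add: field_simps)
      also have "\<dots> \<le> exp (\<delta> * l) * (exp (\<delta> * l) / \<delta>)"
      proof (intro mult_left_mono)
        have "\<delta> * l \<le> exp (\<delta> * l)" using exp_ge_add_one_self[of "\<delta> * l"] by linarith
        then show "l \<le> exp (\<delta> * l) / \<delta>" using \<delta> by (simp add: field_simps)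
      qed auto
      also have "\<dots> = (1 / \<delta>) * exp (2 * \<delta> * l)" by (simp add: exp_double mult.assoc power2_eq_square)
      also have "\<dots> \<le> (1 / \<delta>) * exp (2 * \<delta> * (real d * ln (1 + coord_sum x) + B))"
        using lle \<delta> by (intro mult_left_mono) auto
      also have "\<dots> = (1 / \<delta>) * (exp (2 * \<delta> * B) * (1 + coord_sum x) powr (2 * \<delta> * real d))"
        using c by (simp add: powr_def algebra_simps flip: exp_add)
      finally show "norm (exp (- h * Lam x) - 1) / norm h \<le> (1 / \<delta>) * (exp (2 * \<delta> * B) * (1 + coord_sum x) powr (2 * \<delta> * real d))" .
    qed (use C \<delta> in auto)
    also have "\<dots> = W x" unfolding W_def by (simp add: powr_add algebra_simps)
    finally show ?thesis .
  qed
  have "((\<lambda>s. (zint s m g - zint s0 m g) / (s - s0)) \<longlongrightarrow> 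
      (LINT x:orthant|lborel. - Lam x * integrand s0 m g x)) (at s0 within ball s0 \<delta>)"
    unfolding tendsto_at_iff_sequentially
  proof (intro allI impI)
    fix X :: "nat \<Rightarrow> complex"
    assume X: "\<forall>i. X i \<in> ball s0 \<delta> - {s0}" and Xl: "X \<longlonglongrightarrow> s0"
    have conv: "real_of_int (weight m k) < Re (X i) * real d" for i
    proof -
      have "\<bar>Re (X i) - Re s0\<bar> < \<delta>"
        using X[rule_format, of i] abs_Re_le_cmod[of "X i - s0"]
        by (auto simp: dist_norm norm_minus_commute)
      then have "Re (X i) > Re s0 - \<delta>" by linarith
      then have "real d * Re (X i) > real d * (Re s0 - \<delta>)" using d by simp
      then have "growth (X i) m k < q + real d * \<delta>" by (simp add: growth_def q_def algebra_simps)
      also have "\<dots> \<le> q + 2 * \<delta> * real d" using \<delta> by simp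
      also note q2
      finally show ?thesis by (simp add: growth_less_iff)
    qed
    have atX: "filterlim X (at s0) sequentially"
      unfolding filterlim_at using Xl X by auto
    have "(\<lambda>i. LINT x|lborel. indicator orthant x *\<^sub>R ((integrand (X i) m g x - integrand s0 m g x) / (X i - s0)))
       \<longlonglongrightarrow> (LINT x|lborel. indicator orthant x *\<^sub>R (- Lam x * integrand s0 m g x))"
    proof (rule integral_dominated_convergence[where w = "\<lambda>x. indicator orthant x *\<^sub>R W x"])
      show "(\<lambda>x. indicator orthant x *\<^sub>R (- Lam x * integrand s0 m g x)) \<in> borel_measurable lborel"
      proof -
        have "continuous_on orthant (\<lambda>x. - Lam x * integrand s0 m g x)"
          by (intro continuous_intros contLam continuous_on_integrand[OF g])
        from borel_measurable_continuous_on_indicator[OF borel_orthant this] show ?thesis by simp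
      qed
      show "(\<lambda>x. indicator orthant x *\<^sub>R ((integrand (X i) m g x - integrand s0 m g x) / (X i - s0)))
          \<in> borel_measurable lborel" for i
      proof -
        have "continuous_on orthant (\<lambda>x. (integrand (X i) m g x - integrand s0 m g x) / (X i - s0))"
          using X[rule_format, of i] by (intro continuous_intros continuous_on_integrand[OF g]) auto
        then show ?thesis by (simp add: borel_measurable_continuous_on_indicator)
      qed
      show "integrable lborel (\<lambda>x. indicator orthant x *\<^sub>R W x)"
        using set_integrable_powr[OF q2] unfolding W_def set_integrable_def[symmetric] by simp
      show "AE x in lborel. (\<lambda>i. indicator orthant x *\<^sub>R ((integrand (X i) m g x - integrand s0 m g x) / (X i - s0)))
         \<longlonglongrightarrow> indicator orthant x *\<^sub>R (- Lam x * integrand s0 m g x)"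
      proof (intro AE_I2 tendsto_scaleR[OF tendsto_const])
        fix x
        have "((\<lambda>s. exp (- s * Lam x)) has_field_derivative - Lam x * exp (- s0 * Lam x)) (at s0)"
          by (auto intro!: derivative_eq_intros)
        from DERIV_cmult[OF this, of "g x / F x ^ m"]
        have "((\<lambda>s. integrand s m g x) has_field_derivative - Lam x * integrand s0 m g x) (at s0)"
          by (simp add: integrand_def mult_ac)
        then have "((\<lambda>s. (integrand s m g x - integrand s0 m g x) / (s - s0)) \<longlongrightarrow> - Lam x * integrand s0 m g x) (at s0)"
          by (simp add: has_field_derivative_iff)
        from filterlim_compose[OF this atX]
        show "(\<lambda>i. (integrand (X i) m g x - integrand s0 m g x) / (X i - s0)) \<longlonglongrightarrow> - Lam x * integrand s0 m g x" .
      qed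
      show "AE x in lborel. norm (indicator orthant x *\<^sub>R ((integrand (X i) m g x - integrand s0 m g x) / (X i - s0)))
         \<le> indicator orthant x *\<^sub>R W x" for i
        using key[OF _ X[rule_format]] by (auto simp: indicator_def)
    qed
    moreover have "(LINT x|lborel. indicator orthant x *\<^sub>R ((integrand (X i) m g x - integrand s0 m g x) / (X i - s0)))
      = (zint (X i) m g - zint s0 m g) / (X i - s0)" for i
    proof -
      have "(LINT x:orthant|lborel. (integrand (X i) m g x - integrand s0 m g x) / (X i - s0))
        = (LINT x:orthant|lborel. (integrand (X i) m g x - integrand s0 m g x)) / (X i - s0)"
        by (rule set_integral_divide_zero)
      also have "(LINT x:orthant|lborel. (integrand (X i) m g x - integrand s0 m g x)) = zint (X i) m g - zint s0 m g"
        unfolding zint_def by (intro set_integral_diff set_integrable_integrand[OF g] conv s0)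
      finally show ?thesis unfolding set_lebesgue_integral_def .
    qed
    ultimately show "((\<lambda>s. (zint s m g - zint s0 m g) / (s - s0)) \<circ> X) \<longlonglongrightarrow>
        (LINT x:orthant|lborel. - Lam x * integrand s0 m g x)"
      by (simp add: o_def set_lebesgue_integral_def)
  qed
  then have "((\<lambda>s. zint s m g) has_field_derivative (LINT x:orthant|lborel. - Lam x * integrand s0 m g x)) (at s0 within ball s0 \<delta>)"
    by (simp add: has_field_derivative_iff)
  then have "((\<lambda>s. zint s m g) has_field_derivative (LINT x:orthant|lborel. - Lam x * integrand s0 m g x)) (at s0)"
    using \<delta> by (simp add: at_within_open[OF _ open_ball])
  then show "(\<lambda>s. zint s m g) field_differentiable at s0 within {s. real_of_int (weight m k) < Re s * real d}"
    by (metis field_differentiable_at_within field_differentiable_def)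
qed

end

subsection \<open>Meromorphic continuation\<close>

lemma nicely_meromorphic_eq_remove_sings:
  assumes "f nicely_meromorphic_on A" "z \<in> A"
  shows "remove_sings f z = f z"
  using assms unfolding nicely_meromorphic_on_def by auto

text \<open>Identity theorem: the difference is either zero or nonzero off a sparse set, and
  agreement on \<open>U\<close> excludes the latter. Equality off a sparse set becomes equality at
  every point because \<open>remove_sings\<close> recovers the values of nicely meromorphic
  functions.\<close>

lemma nicely_meromorphic_unique:
  assumes f: "f nicely_meromorphic_on A" and g: "g nicely_meromorphic_on A"
    and A: "open A" "connected A" and U: "open U" "U \<noteq> {}" "U \<subseteq> A"
    and eq: "\<And>z. z \<in> U \<Longrightarrow> f z = g z" and z: "z \<in> A"
  shows "f z = g z"
proof -
  have "(\<lambda>z. f z - g z) meromorphic_on A"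
    using f g unfolding nicely_meromorphic_on_def by (auto intro: meromorphic_intros)
  then have "(\<forall>\<^sub>\<approx>z\<in>A. f z - g z = 0) \<or> (\<forall>\<^sub>\<approx>z\<in>A. f z - g z \<noteq> 0)"
    by (rule meromorphic_imp_constant_or_avoid) (use A in auto)
  moreover have "\<not> (\<forall>\<^sub>\<approx>z\<in>A. f z - g z \<noteq> 0)"
  proof
    assume *: "\<forall>\<^sub>\<approx>z\<in>A. f z - g z \<noteq> 0"
    obtain u where u: "u \<in> U" using U by blast
    then have "eventually (\<lambda>z. f z - g z \<noteq> 0) (at u)"
      using * U A by (auto simp: eventually_cosparse_open_eq)
    moreover have "eventually (\<lambda>z. z \<in> U) (at u)"
      using U u by (intro eventually_at_in_open') auto
    ultimately have "eventually (\<lambda>z. False) (at u)"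
      by eventually_elim (use eq in auto)
    then show False by simp
  qed
  ultimately have "eventually (\<lambda>z. f z - g z = 0) (at z)"
    using z A by (auto simp: eventually_cosparse_open_eq)
  then have "eventually (\<lambda>z. f z = g z) (at z)" by simp
  then have "remove_sings f z = remove_sings g z" by (intro remove_sings_cong) auto
  then show ?thesis
    using nicely_meromorphic_eq_remove_sings[OF f z] nicely_meromorphic_eq_remove_sings[OF g z] by simp
qed

text \<open>The recursion yields one continuation per half-plane, and these are known to agree on
  \<open>U\<close> only. After normalization by \<open>remove_sings\<close> the identity theorem
  makes them agree on overlaps, so the least admissible index gives the same value as any
  other.\<close>

lemma nicely_meromorphic_glue:
  fixes A :: "nat \<Rightarrow> complex set"
  assumes A: "\<And>n. open (A n)" "\<And>n. connected (A n)" "incseq A" "(\<Union>n. A n) = UNIV"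
    and U: "open U" "U \<noteq> {}" "\<And>n. U \<subseteq> A n"
    and J: "\<And>n. J n meromorphic_on A n" "\<And>n s. s \<in> U \<Longrightarrow> J n s = I s"
    and I: "I holomorphic_on U"
  obtains F where "F nicely_meromorphic_on UNIV" "\<And>s. s \<in> U \<Longrightarrow> F s = I s"
    "\<And>n s. s \<in> A n \<Longrightarrow> F s = remove_sings (J n) s"
proof -
  define F where "F s = remove_sings (J (LEAST n. s \<in> A n)) s" for s
  have nice: "remove_sings (J n) nicely_meromorphic_on A n" for n
    by (rule remove_sings_nicely_meromorphic[OF J(1)])
  have RU: "remove_sings (J n) s = I s" if s: "s \<in> U" for n s
  proof (rule remove_sings_eqI)
    have "isCont I s"
      using I U(1) s by (metis continuous_on_eq_continuous_at holomorphic_on_imp_continuous_on)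
    then have "I \<midarrow>s\<rightarrow> I s" by (simp add: isCont_def)
    moreover have "eventually (\<lambda>z. I z = J n z) (at s)"
      using eventually_at_in_open'[OF U(1) s] by eventually_elim (use J(2) in auto)
    ultimately show "J n \<midarrow>s\<rightarrow> I s" by (rule Lim_transform_eventually)
  qed
  have FA: "F s = remove_sings (J n) s" if s: "s \<in> A n" for n s
  proof -
    define n0 where "n0 = (LEAST n. s \<in> A n)"
    have n0: "s \<in> A n0" "n0 \<le> n" unfolding n0_def using s by (auto intro: LeastI Least_le)
    have sub: "A n0 \<subseteq> A n" using A(3) n0(2) by (simp add: incseq_def)
    have "remove_sings (J n0) s = remove_sings (J n) s"
      by (rule nicely_meromorphic_unique[OF nice nicely_meromorphic_on_subset[OF nice sub]
            A(1,2) U(1,2,3) _ n0(1)]) (simp add: RU)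
    then show ?thesis by (simp add: F_def n0_def)
  qed
  have "F nicely_meromorphic_on UNIV"
  proof -
    have *: "F meromorphic_on {z} \<and> (is_pole F z \<and> F z = 0 \<or> F \<midarrow>z\<rightarrow> F z)" for z
    proof -
      obtain n where n: "z \<in> A n" using A(4) by blast
      let ?R = "remove_sings (J n)"
      have ev: "eventually (\<lambda>w. F w = ?R w) (at z)"
        using eventually_at_in_open'[OF A(1) n] by eventually_elim (use FA in auto)
      have "F meromorphic_on {z} \<longleftrightarrow> ?R meromorphic_on {z}"
        using ev by (intro meromorphic_on_cong) auto
      moreover have "?R meromorphic_on {z}"
        using meromorphic_on_subset[of ?R "A n" "{z}"] nice[of n] n
        by (auto simp: nicely_meromorphic_on_def)
      moreover have "is_pole F z \<longleftrightarrow> is_pole ?R z" using ev by (intro is_pole_cong) auto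
      moreover have "F \<midarrow>z\<rightarrow> F z \<longleftrightarrow> ?R \<midarrow>z\<rightarrow> ?R z"
        using FA[OF n] ev by (intro filterlim_cong) auto
      ultimately show ?thesis
        using nice[of n] n FA[OF n] unfolding nicely_meromorphic_on_def by auto
    qed
    then show ?thesis
      unfolding nicely_meromorphic_on_def using meromorphic_on_meromorphic_at by blast
  qed
  then show thesis using that FA RU U by (metis subsetD)
qed

lemma open_half_plane: "open {s. a < Re s * b}"
  by (intro open_Collect_less continuous_intros)

lemma connected_half_plane: "connected {s. a < Re s * b}"
proof -
  have "{s. a < Re s * b} = {s. inner (Complex b 0) s > a}"
    by (auto simp: inner_complex_def mult.commute)
  then show ?thesis by (simp add: convex_connected convex_halfspace_gt)
qed

section \<open>Continuation by the recursion and behaviour at \<open>s = 0\<close>\<close>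

context radial_log
begin

text \<open>With negative weight the point 0 lies inside the half-plane of convergence, so no
  continuation is involved.\<close>

lemma zint_tendsto:
  assumes g: "homogeneous k g" and neg: "weight m k < 0"
  shows "(\<lambda>s. zint s m g) \<midarrow>0\<rightarrow> zint 0 m g"
    and "eventually (\<lambda>s. real_of_int (weight m k) < Re s * real d) (at 0)"
proof -
  have 0: "0 \<in> {s. real_of_int (weight m k) < Re s * real d}" using neg by simp
  show "(\<lambda>s. zint s m g) \<midarrow>0\<rightarrow> zint 0 m g"
    using continuous_on_eq_continuous_at[OF open_half_plane] 0
      holomorphic_on_imp_continuous_on[OF zint_holomorphic[OF g, of m]]
    by (metis isCont_def)
  show "eventually (\<lambda>s. real_of_int (weight m k) < Re s * real d) (at 0)"
    using eventually_at_in_open'[OF open_half_plane 0] by simp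
qed

lemma zeta_residue_neg: "weight m k < 0 \<Longrightarrow> zeta_residue N m k g = 0"
  by (cases N) auto

text \<open>Solving the recursion for the integral of index \<open>m\<close> gains one unit of
  \<open>Re s * d\<close> per induction step. The condition \<open>weight m k < int N\<close> says
  that 0 has entered the domain; only then is a limit claimed there.\<close>

lemma zint_continuation:
  assumes "homogeneous k g"
  shows "\<exists>J. J meromorphic_on {s. real_of_int (weight m k) - real N < Re s * real d} \<and>
     (\<forall>s. real_of_int (weight m k) < Re s * real d \<longrightarrow> J s = zint s m g) \<and>
     (weight m k < int N \<longrightarrow> (\<lambda>s. s * of_nat d * J s) \<midarrow>0\<rightarrow> zeta_residue N m k g)"
  using assms
proof (induction N arbitrary: m k g)
  \<comment> \<open>The function is regular at 0, so the factor \<open>s\<close> forces the limit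
    0.\<close>
  have negative: "(\<lambda>s. s * of_nat d * J s) \<midarrow>0\<rightarrow> zeta_residue N m k g"
    if neg: "weight m k < 0" and g: "homogeneous k g"
      and J: "\<forall>s. real_of_int (weight m k) < Re s * real d \<longrightarrow> J s = zint s m g" for J N m k g
  proof -
    have "(\<lambda>s. s * of_nat d * zint s m g) \<midarrow>0\<rightarrow> 0 * of_nat d * zint 0 m g"
      by (intro tendsto_intros zint_tendsto(1)[OF g neg])
    then have "(\<lambda>s. s * of_nat d * J s) \<midarrow>0\<rightarrow> 0 * of_nat d * zint 0 m g"
      by (rule Lim_transform_eventually)
        (use zint_tendsto(2)[OF g neg] J in \<open>auto elim!: eventually_mono\<close>)
    then show ?thesis using zeta_residue_neg[OF neg] by simp
  qed
  {
    case 0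
    have "(\<lambda>s. zint s m g) meromorphic_on {s. real_of_int (weight m k) < Re s * real d}"
      using zint_holomorphic[OF 0, of m] open_half_plane
      by (simp add: analytic_on_open analytic_on_imp_meromorphic_on)
    then show ?case
      using negative[OF _ 0, where J = "\<lambda>s. zint s m g" and N = 0] by (intro exI[of _ "\<lambda>s. zint s m g"]) auto
  next
    case (Suc N)
    note g = Suc.prems
    let ?w = "weight m k"
    have hH: "homogeneous (k + i) (\<lambda>x. g x * H i x)" if "i < D" for i
      by (rule homogeneous_mult[OF g homH[OF that]])
    have hHL: "homogeneous (k + i) (\<lambda>x. g x * HL i x)" if "i < D" for i
      by (rule homogeneous_mult[OF g homHL[OF that]])
    have "\<forall>i\<in>{..<D}. \<exists>J. J meromorphic_on {s. real_of_int (weight (Suc m) (k+i)) - real N < Re s * real d} \<and>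
     (\<forall>s. real_of_int (weight (Suc m) (k+i)) < Re s * real d \<longrightarrow> J s = zint s (Suc m) (\<lambda>x. g x * H i x)) \<and>
     (weight (Suc m) (k+i) < int N \<longrightarrow> (\<lambda>s. s * of_nat d * J s) \<midarrow>0\<rightarrow> zeta_residue N (Suc m) (k+i) (\<lambda>x. g x * H i x))"
      using Suc.IH[OF hH] by blast
    then obtain J1 where J1: "\<And>i. i < D \<Longrightarrow> J1 i meromorphic_on {s. real_of_int (weight (Suc m) (k+i)) - real N < Re s * real d}"
      "\<And>i s. i < D \<Longrightarrow> real_of_int (weight (Suc m) (k+i)) < Re s * real d \<Longrightarrow> J1 i s = zint s (Suc m) (\<lambda>x. g x * H i x)"
      "\<And>i. i < D \<Longrightarrow> weight (Suc m) (k+i) < int N \<Longrightarrow> (\<lambda>s. s * of_nat d * J1 i s) \<midarrow>0\<rightarrow> zeta_residue N (Suc m) (k+i) (\<lambda>x. g x * H i x)"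
      by (auto simp: bchoice_iff)
    have "\<forall>i\<in>{..<D}. \<exists>J. J meromorphic_on {s. real_of_int (weight (Suc m) (k+i)) - real N < Re s * real d} \<and>
     (\<forall>s. real_of_int (weight (Suc m) (k+i)) < Re s * real d \<longrightarrow> J s = zint s (Suc m) (\<lambda>x. g x * HL i x)) \<and>
     (weight (Suc m) (k+i) < int N \<longrightarrow> (\<lambda>s. s * of_nat d * J s) \<midarrow>0\<rightarrow> zeta_residue N (Suc m) (k+i) (\<lambda>x. g x * HL i x))"
      using Suc.IH[OF hHL] by blast
    then obtain J2 where J2: "\<And>i. i < D \<Longrightarrow> J2 i meromorphic_on {s. real_of_int (weight (Suc m) (k+i)) - real N < Re s * real d}"
      "\<And>i s. i < D \<Longrightarrow> real_of_int (weight (Suc m) (k+i)) < Re s * real d \<Longrightarrow> J2 i s = zint s (Suc m) (\<lambda>x. g x * HL i x)"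
      "\<And>i. i < D \<Longrightarrow> weight (Suc m) (k+i) < int N \<Longrightarrow> (\<lambda>s. s * of_nat d * J2 i s) \<midarrow>0\<rightarrow> zeta_residue N (Suc m) (k+i) (\<lambda>x. g x * HL i x)"
      by (auto simp: bchoice_iff)
    \<comment> \<open>The recursion solved for its left-hand integral, with continuations in place
      of the integrals on the right.\<close>
    define J where "J s = (\<Sum>i<D. of_nat m * J1 i s + s * J2 i s) / (s * of_nat d - of_int ?w)" for s
    have step: "real_of_int (weight (Suc m) (k+i)) \<le> real_of_int ?w - 1" if "i < D" for i
      using weight_step[OF that, of m k] by linarith
    have mero: "J meromorphic_on {s. real_of_int ?w - real (Suc N) < Re s * real d}"
    proof -
      have "J1 i meromorphic_on {s. real_of_int ?w - real (Suc N) < Re s * real d}" 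
        "J2 i meromorphic_on {s. real_of_int ?w - real (Suc N) < Re s * real d}" if "i < D" for i
        using J1(1)[OF that] J2(1)[OF that] step[OF that] by (auto elim!: meromorphic_on_subset)
      then show ?thesis unfolding J_def by (intro meromorphic_intros) auto
    qed
    have agree: "\<forall>s. real_of_int ?w < Re s * real d \<longrightarrow> J s = zint s m g"
    proof (intro allI impI)
      fix s assume s: "real_of_int ?w < Re s * real d"
      have "s * of_nat d - of_int ?w \<noteq> 0"
      proof
        assume "s * of_nat d - of_int ?w = 0"
        then have "Re (s * of_nat d - of_int ?w) = 0" by simp
        then show False using s by simp
      qed
      moreover have "(\<Sum>i<D. of_nat m * J1 i s + s * J2 i s) = (s * of_nat d - of_int ?w) * zint s m g"
        unfolding zint_recursion[OF g s]
      proof (intro sum.cong refl)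
        fix i assume "i \<in> {..<D}"
        then have i: "i < D" by simp
        then have "real_of_int (weight (Suc m) (k+i)) < Re s * real d" using step[OF i] s by linarith
        then show "of_nat m * J1 i s + s * J2 i s = 
            of_nat m * zint s (Suc m) (\<lambda>x. g x * H i x) + s * zint s (Suc m) (\<lambda>x. g x * HL i x)"
          using J1(2)[OF i] J2(2)[OF i] by simp
      qed
      ultimately show "J s = zint s m g" by (simp add: J_def)
    qed
    have lim: "(\<lambda>s. s * of_nat d * J s) \<midarrow>0\<rightarrow> zeta_residue (Suc N) m k g" if wN: "?w < int (Suc N)"
    proof (rule linorder_cases[of ?w 0])
      assume "?w < 0"
      then show ?thesis by (rule negative[OF _ g agree])
    next
      assume w0: "?w = 0"
      \<comment> \<open>The denominator is now \<open>s * d\<close> and cancels against the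
        prefactor. The integrals on the right converge at 0, and those with \<open>HL\<close>
        disappear with their factor \<open>s\<close>.\<close>
      have neg: "weight (Suc m) (k + i) < 0" if "i < D" for i
        using weight_step[OF that, of m k] w0 by linarith
      have l1: "J1 i \<midarrow>0\<rightarrow> zint 0 (Suc m) (\<lambda>x. g x * H i x)" if i: "i < D" for i
        by (rule Lim_transform_eventually[OF zint_tendsto(1)[OF hH[OF i] neg[OF i]]])
          (use zint_tendsto(2)[OF hH[OF i] neg[OF i]] J1(2)[OF i] in \<open>auto elim!: eventually_mono\<close>)
      have l2: "J2 i \<midarrow>0\<rightarrow> zint 0 (Suc m) (\<lambda>x. g x * HL i x)" if i: "i < D" for i
        by (rule Lim_transform_eventually[OF zint_tendsto(1)[OF hHL[OF i] neg[OF i]]])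
          (use zint_tendsto(2)[OF hHL[OF i] neg[OF i]] J2(2)[OF i] in \<open>auto elim!: eventually_mono\<close>)
      have "(\<lambda>s. \<Sum>i<D. of_nat m * J1 i s + s * J2 i s) \<midarrow>0\<rightarrow> 
          (\<Sum>i<D. of_nat m * zint 0 (Suc m) (\<lambda>x. g x * H i x) + 0 * zint 0 (Suc m) (\<lambda>x. g x * HL i x))"
        by (intro tendsto_intros l1 l2) auto
      then have "(\<lambda>s. s * of_nat d * J s) \<midarrow>0\<rightarrow> 
          (\<Sum>i<D. of_nat m * zint 0 (Suc m) (\<lambda>x. g x * H i x) + 0 * zint 0 (Suc m) (\<lambda>x. g x * HL i x))"
        by (rule Lim_transform_eventually)
          (use d w0 in \<open>auto simp: J_def eventually_at_filter intro!: always_eventually\<close>)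
      then show ?thesis
        using w0 by (simp add: zint_def integrand_def sum_distrib_left)
    next
      assume w: "?w > 0"
      \<comment> \<open>The denominator tends to \<open>- ?w\<close>, which is nonzero, so this step
        creates no pole at 0. The \<open>HL\<close> terms have one factor \<open>s\<close> beyond
        what makes them converge, hence vanish in the limit.\<close>
      have less: "weight (Suc m) (k + i) < int N" if "i < D" for i
        using weight_step[OF that, of m k] wN by linarith
      have "(\<lambda>s. (\<Sum>i<D. of_nat m * (s * of_nat d * J1 i s) + s * (s * of_nat d * J2 i s)) / (s * of_nat d - of_int ?w)) \<midarrow>0\<rightarrow> 
          (\<Sum>i<D. of_nat m * zeta_residue N (Suc m) (k+i) (\<lambda>x. g x * H i x) + 
             0 * zeta_residue N (Suc m) (k+i) (\<lambda>x. g x * HL i x)) / (0 * of_nat d - of_int ?w)"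
        by (intro tendsto_intros J1(3) J2(3) less) (use w in auto)
      moreover have "(\<Sum>i<D. of_nat m * zeta_residue N (Suc m) (k+i) (\<lambda>x. g x * H i x) + 
             0 * zeta_residue N (Suc m) (k+i) (\<lambda>x. g x * HL i x)) / (0 * of_nat d - of_int ?w)
         = zeta_residue (Suc N) m k g"
        using w by (simp add: sum_distrib_left sum_negf sum_divide_distrib)
      moreover have "(\<Sum>i<D. of_nat m * (s * of_nat d * J1 i s) + s * (s * of_nat d * J2 i s)) / (s * of_nat d - of_int ?w)
         = s * of_nat d * J s" for s
        by (simp add: J_def sum_distrib_left algebra_simps)
      ultimately show ?thesis by simp
    qed
    show ?case using mero agree lim by blast
  }
qed

text \<open>For \<open>m = 0\<close> the \<open>H\<close> terms drop out and a factor
  \<open>s\<close> remains in front of integrals of index 1. It meets at most their simple pole, so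
  the limit at 0 exists. The fuel \<open>k + CARD('p)\<close> suffices because the weights of index
  1 are at most \<open>k + CARD('p) - 1\<close>.\<close>

lemma zint_global:
  assumes g: "homogeneous k g"
  obtains Z where "Z nicely_meromorphic_on UNIV"
    "\<And>s. real (k + CARD('p)) < Re s * real d \<Longrightarrow> Z s = zint s 0 g"
    "(\<lambda>s. of_nat d * Z s) \<midarrow>0\<rightarrow> - (\<Sum>i<D. zeta_residue (k + CARD('p)) 1 (k + i) (\<lambda>x. g x * HL i x)) / of_nat (k + CARD('p))"
proof -
  let ?w = "k + CARD('p)"
  have w0: "weight 0 k = int ?w" by (simp add: weight_def)
  have wpos: "?w > 0" by simp
  have hHL: "homogeneous (k + i) (\<lambda>x. g x * HL i x)" if "i < D" for i
    by (rule homogeneous_mult[OF g homHL[OF that]])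
  have "\<forall>i\<in>{..<D}. \<forall>N. \<exists>J. J meromorphic_on {s. real_of_int (weight 1 (k+i)) - real N < Re s * real d} \<and>
     (\<forall>s. real_of_int (weight 1 (k+i)) < Re s * real d \<longrightarrow> J s = zint s 1 (\<lambda>x. g x * HL i x)) \<and>
     (weight 1 (k+i) < int N \<longrightarrow> (\<lambda>s. s * of_nat d * J s) \<midarrow>0\<rightarrow> zeta_residue N 1 (k+i) (\<lambda>x. g x * HL i x))"
    using zint_continuation[OF hHL] by blast
  then obtain K where K: "\<And>i N. i < D \<Longrightarrow> K i N meromorphic_on {s. real_of_int (weight 1 (k+i)) - real N < Re s * real d}"
    "\<And>i N s. i < D \<Longrightarrow> real_of_int (weight 1 (k+i)) < Re s * real d \<Longrightarrow> K i N s = zint s 1 (\<lambda>x. g x * HL i x)"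
    "\<And>i N. i < D \<Longrightarrow> weight 1 (k+i) < int N \<Longrightarrow> (\<lambda>s. s * of_nat d * K i N s) \<midarrow>0\<rightarrow> zeta_residue N 1 (k+i) (\<lambda>x. g x * HL i x)"
    unfolding bchoice_iff choice_iff by auto
  have step: "weight 1 (k+i) \<le> int ?w - 1" if "i < D" for i
    using weight_step[OF that, of 0 k] w0 by simp
  have stepr: "real_of_int (weight 1 (k+i)) \<le> real ?w - 1" if "i < D" for i
    using step[OF that] by linarith
  define J where "J N s = s * (\<Sum>i<D. K i N s) / (s * of_nat d - of_nat ?w)" for N s
  \<comment> \<open>\<open>Suc N\<close> rather than \<open>N\<close>: the weights of index 1 lie at
    least one below \<open>?w\<close>, so \<open>N\<close> steps of continuation for them reach this
    far.\<close>
  define A where "A N = {s. real ?w - real (Suc N) < Re s * real d}" for N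
  define U where "U = {s. real ?w < Re s * real d}"
  have mero: "J N meromorphic_on A N" for N
  proof -
    have "K i N meromorphic_on A N" if "i < D" for i
      using K(1)[OF that] by (rule meromorphic_on_subset) (use stepr[OF that] in \<open>auto simp: A_def\<close>)
    then show ?thesis unfolding J_def by (intro meromorphic_intros) auto
  qed
  have oA: "open (A n)" for n by (auto simp: A_def open_half_plane)
  have "J N s = zint s 0 g" if "s \<in> U" for N s
  proof -
    have s: "real_of_int (weight 0 k) < Re s * real d" using that by (simp add: U_def w0)
    have "s * of_nat d - of_nat ?w \<noteq> 0"
    proof
      assume "s * of_nat d - of_nat ?w = 0"
      then have "Re (s * of_nat d - of_nat ?w) = 0" by simp
      then show False using that by (simp add: U_def)
    qed
    moreover have "(s * of_nat d - of_nat ?w) * zint s 0 g = s * (\<Sum>i<D. zint s 1 (\<lambda>x. g x * HL i x))"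
      using zint_recursion[OF g s] by (simp add: w0 sum_distrib_left)
    moreover have "(\<Sum>i<D. K i N s) = (\<Sum>i<D. zint s 1 (\<lambda>x. g x * HL i x))"
    proof (intro sum.cong refl K(2))
      fix i assume i: "i \<in> {..<D}"
      then show "real_of_int (weight 1 (k+i)) < Re s * real d" using stepr[of i] that by (simp add: U_def)
    qed simp
    ultimately show ?thesis by (simp add: J_def field_simps)
  qed
  moreover have "(\<lambda>s. zint s 0 g) holomorphic_on U"
    using zint_holomorphic[OF g, of 0] by (simp add: U_def w0)
  moreover have "incseq A" by (auto simp: incseq_def A_def)
  moreover have "(\<Union>n. A n) = UNIV"
  proof -
    have "\<exists>n. s \<in> A n" for s
    proof -
      obtain n where "real ?w - Re s * real d < real n" using reals_Archimedean2 by blast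
      then show ?thesis by (auto simp: A_def algebra_simps intro!: exI[of _ n])
    qed
    then show ?thesis by blast
  qed
  moreover have "U \<noteq> {}"
  proof -
    have "of_real ((real ?w + 1) / real d) \<in> U" using d by (simp add: U_def)
    then show ?thesis by blast
  qed
  moreover note mero oA
  moreover have "connected (A n)" "open U" "U \<subseteq> A n" for n
    by (auto simp: A_def U_def open_half_plane connected_half_plane)
  ultimately obtain Z where Z: "Z nicely_meromorphic_on UNIV" "\<And>s. s \<in> U \<Longrightarrow> Z s = zint s 0 g"
    "\<And>n s. s \<in> A n \<Longrightarrow> Z s = remove_sings (J n) s"
    using nicely_meromorphic_glue[of A U J "\<lambda>s. zint s 0 g"] by metis
  let ?V = "- (\<Sum>i<D. zeta_residue ?w 1 (k + i) (\<lambda>x. g x * HL i x)) / of_nat ?w :: complex"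
  \<comment> \<open>The index \<open>?w\<close> is the fuel appearing in \<open>?V\<close>, and it
    is also large enough for 0 to lie in \<open>A ?w\<close>.\<close>
  have lim: "(\<lambda>s. of_nat d * J ?w s) \<midarrow>0\<rightarrow> ?V"
  proof -
    have "(\<lambda>s. (\<Sum>i<D. s * of_nat d * K i ?w s) / (s * of_nat d - of_nat ?w)) \<midarrow>0\<rightarrow> 
       (\<Sum>i<D. zeta_residue ?w 1 (k + i) (\<lambda>x. g x * HL i x)) / (0 * of_nat d - of_nat ?w)"
    proof (intro tendsto_intros K(3))
      show "weight 1 (k + i) < int ?w" if "i \<in> {..<D}" for i using step[of i] that by simp
    qed (use wpos in \<open>auto simp del: of_nat_add\<close>)
    moreover have "(\<Sum>i<D. s * of_nat d * K i ?w s) / (s * of_nat d - of_nat ?w) = of_nat d * J ?w s" for s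
      by (simp add: J_def sum_distrib_left mult_ac)
    ultimately show ?thesis by (simp del: of_nat_add)
  qed
  \<comment> \<open>The comparison takes place in a punctured neighbourhood of 0, where
    \<open>remove_sings\<close> changes nothing.\<close>
  have "eventually (\<lambda>s. Z s = J ?w s) (at 0)"
  proof -
    have 0: "0 \<in> A ?w" by (simp add: A_def)
    have "eventually (\<lambda>s. Z s = remove_sings (J ?w) s) (at 0)"
      using eventually_at_in_open'[OF oA 0] by eventually_elim (use Z(3) in auto)
    moreover have "eventually (\<lambda>s. remove_sings (J ?w) s = J ?w s) (at 0)"
      using mero[of ?w] 0 by (intro eventually_remove_sings_eq_at) (auto simp: meromorphic_on_altdef)
    ultimately show ?thesis by eventually_elim simp
  qed
  then have "(\<lambda>s. of_nat d * Z s) \<midarrow>0\<rightarrow> ?V"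
    by (intro Lim_transform_eventually[OF lim]) (erule eventually_mono, simp)
  then show thesis using that Z(1,2) by (auto simp: U_def)
qed

text \<open>Additivity is delicate only at weight 0, where integrals are split. There the products
  with \<open>H i\<close> have negative weight, so they are integrable as
  \<open>integrand 0\<close>, in which the exponential factor is 1.\<close>

lemma zeta_residue_sum:
  assumes "finite S" "\<And>j. j \<in> S \<Longrightarrow> homogeneous k (g j)"
  shows "zeta_residue N m k (\<lambda>x. \<Sum>j\<in>S. g j x) = (\<Sum>j\<in>S. zeta_residue N m k (g j))"
  using assms(2)
proof (induction N arbitrary: m k g)
  case 0
  show ?case by simp
next
  case (Suc N)
  have hH: "homogeneous (k + i) (\<lambda>x. g j x * H i x)" if "i < D" "j \<in> S" for i j
    by (rule homogeneous_mult[OF Suc.prems[OF that(2)] homH[OF that(1)]])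
  have zero_case: "(LINT x:orthant|lborel. (\<Sum>j\<in>S. g j x) * H i x / F x ^ Suc m) =
      (\<Sum>j\<in>S. LINT x:orthant|lborel. g j x * H i x / F x ^ Suc m)" if w: "weight m k = 0" and i: "i < D" for i
  proof -
    have "set_integrable lborel orthant (\<lambda>x. g j x * H i x / F x ^ Suc m)" if "j \<in> S" for j
    proof -
      have "weight (Suc m) (k + i) < 0" using weight_step[OF i, of m k] w by linarith
      then have "set_integrable lborel orthant (integrand 0 (Suc m) (\<lambda>x. g j x * H i x))"
        by (intro set_integrable_integrand[OF hH[OF i that]]) auto
      then show ?thesis by (simp add: integrand_def[abs_def])
    qed
    from set_integral_sum(2)[OF this, of S] show ?thesis
      by (simp add: sum_distrib_right sum_divide_distrib)
  qed
  have pos_case: "zeta_residue N (Suc m) (k + i) (\<lambda>x. (\<Sum>j\<in>S. g j x) * H i x) =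
    (\<Sum>j\<in>S. zeta_residue N (Suc m) (k + i) (\<lambda>x. g j x * H i x))" if "i < D" for i
    using Suc.IH[OF hH[OF that]] by (simp add: sum_distrib_right)
  consider "weight m k < 0" | "weight m k = 0" | "weight m k > 0" by linarith
  then show ?case
  proof cases
    case 2
    have "(\<Sum>i<D. LINT x:orthant|lborel. (\<Sum>j\<in>S. g j x) * H i x / F x ^ Suc m) =
       (\<Sum>j\<in>S. \<Sum>i<D. LINT x:orthant|lborel. g j x * H i x / F x ^ Suc m)"
      by (subst sum.swap) (intro sum.cong refl zero_case[OF 2], simp)
    then show ?thesis using 2 by (simp add: sum_distrib_left del: power_Suc)
  next
    case 3
    have "(\<Sum>i<D. zeta_residue N (Suc m) (k + i) (\<lambda>x. (\<Sum>j\<in>S. g j x) * H i x)) =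
       (\<Sum>j\<in>S. \<Sum>i<D. zeta_residue N (Suc m) (k + i) (\<lambda>x. g j x * H i x))"
      by (subst sum.swap) (intro sum.cong refl pos_case, simp)
    then show ?thesis using 3 by (simp add: sum_distrib_left)
  qed simp
qed

end

subsection \<open>Polynomials\<close>

definition eval_monom :: "('p::finite \<Rightarrow>\<^sub>0 nat) \<Rightarrow> real ^ 'p \<Rightarrow> complex" where
  "eval_monom m x = (\<Prod>i\<in>UNIV. complex_of_real (x $ i) ^ Poly_Mapping.lookup m i)"

lemma eval_cpoly_eq: "eval_cpoly f x = (\<Sum>m\<in>Poly_Mapping.keys f. Poly_Mapping.lookup f m * eval_monom m x)"
  by (simp add: eval_cpoly_def eval_monom_def)

lemma eval_monom_add: "eval_monom (m + n) x = eval_monom m x * eval_monom n x"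
  by (simp add: eval_monom_def lookup_add power_add prod.distrib)

lemma eval_cpoly_superset:
  "finite A \<Longrightarrow> Poly_Mapping.keys f \<subseteq> A \<Longrightarrow>
    eval_cpoly f x = (\<Sum>m\<in>A. Poly_Mapping.lookup f m * eval_monom m x)"
  unfolding eval_cpoly_eq by (rule sum.mono_neutral_left) (auto simp: in_keys_iff)

lemma eval_cpoly_add: "eval_cpoly (f + g) x = eval_cpoly f x + eval_cpoly g x"
proof -
  let ?A = "Poly_Mapping.keys f \<union> Poly_Mapping.keys g"
  have "Poly_Mapping.keys (f + g) \<subseteq> ?A" by (rule keys_add)
  then show ?thesis
    by (simp add: eval_cpoly_superset[of ?A] lookup_add sum.distrib algebra_simps)
qed

lemma eval_cpoly_single: "eval_cpoly (Poly_Mapping.single m c) x = c * eval_monom m x"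
  by (simp add: eval_cpoly_superset[of "{m}"])

lemma eval_cpoly_zero [simp]: "eval_cpoly 0 x = 0"
  by (simp add: eval_cpoly_eq)

lemma eval_cpoly_sum: "eval_cpoly (\<Sum>a\<in>A. f a) x = (\<Sum>a\<in>A. eval_cpoly (f a) x)"
  by (induction A rule: infinite_finite_induct) (auto simp: eval_cpoly_add)

lemma eval_cpoly_one [simp]: "eval_cpoly 1 x = 1"
proof -
  have "eval_cpoly (Poly_Mapping.single 0 1) x = 1"
    unfolding eval_cpoly_single by (simp add: eval_monom_def)
  then show ?thesis by simp
qed

lemma cpoly_sum_monomials:
  "(f :: 'p cpoly) = (\<Sum>m\<in>Poly_Mapping.keys f. Poly_Mapping.single m (Poly_Mapping.lookup f m))"
  by (rule poly_mapping_eqI) (auto simp: lookup_sum lookup_single when_def in_keys_iff)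

lemma eval_cpoly_mult: "eval_cpoly (f * g) x = eval_cpoly f x * eval_cpoly g x"
proof -
  have "f * g = (\<Sum>m\<in>Poly_Mapping.keys f. \<Sum>n\<in>Poly_Mapping.keys g.
      Poly_Mapping.single (m + n) (Poly_Mapping.lookup f m * Poly_Mapping.lookup g n))"
    by (subst (1) cpoly_sum_monomials[of f], subst (1) cpoly_sum_monomials[of g])
       (simp add: sum_product mult_single)
  then have "eval_cpoly (f * g) x = (\<Sum>m\<in>Poly_Mapping.keys f. \<Sum>n\<in>Poly_Mapping.keys g.
      (Poly_Mapping.lookup f m * eval_monom m x) * (Poly_Mapping.lookup g n * eval_monom n x))"
    by (simp add: eval_cpoly_sum eval_cpoly_single eval_monom_add mult_ac)
  then show ?thesis by (simp add: eval_cpoly_eq sum_product)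
qed

lemma eval_cpoly_prod: "eval_cpoly (\<Prod>a\<in>A. f a) x = (\<Prod>a\<in>A. eval_cpoly (f a) x)"
  by (induction A rule: infinite_finite_induct) (auto simp: eval_cpoly_mult)

section \<open>Total degree and homogeneous components\<close>

lemma monom_degree_UNIV:
  "monom_degree (m :: 'p::finite \<Rightarrow>\<^sub>0 nat) = (\<Sum>i\<in>UNIV. Poly_Mapping.lookup m i)"
  unfolding monom_degree_def by (rule sum.mono_neutral_left) (auto simp: in_keys_iff)

lemma monom_degree_le_total_degree:
  "m \<in> Poly_Mapping.keys f \<Longrightarrow> monom_degree m \<le> total_degree f"
  unfolding total_degree_def by (rule Max_ge) auto

lemma total_degree_leI:
  "(\<And>m. m \<in> Poly_Mapping.keys f \<Longrightarrow> monom_degree m \<le> d) \<Longrightarrow> total_degree f \<le> d"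
  unfolding total_degree_def by (subst Max_le_iff) auto

lemma total_degree_mult_le:
  "total_degree (f * g :: 'p::finite cpoly) \<le> total_degree f + total_degree g"
proof (rule total_degree_leI)
  fix m assume "m \<in> Poly_Mapping.keys (f * g)"
  then obtain a b where "m = a + b" "a \<in> Poly_Mapping.keys f" "b \<in> Poly_Mapping.keys g"
    using keys_mult[of f g] by auto
  then show "monom_degree m \<le> total_degree f + total_degree g"
    using monom_degree_le_total_degree[of a f] monom_degree_le_total_degree[of b g]
    by (simp add: monom_degree_UNIV lookup_add sum.distrib)
qed

lemma total_degree_prod_le:
  "total_degree (\<Prod>a\<in>A. f a :: 'p::finite cpoly) \<le> (\<Sum>a\<in>A. total_degree (f a))"
proof (induction A rule: infinite_finite_induct)
  case (insert a A)
  then show ?case using total_degree_mult_le[of "f a" "\<Prod>a\<in>A. f a"] by simp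
qed (auto simp: total_degree_def monom_degree_def)

lemma total_degree_pos:
  assumes "mahler_hypothesis f"
  shows "total_degree (f :: 'p::finite cpoly) > 0"
proof (rule ccontr)
  assume "\<not> total_degree f > 0"
  then have "monom_degree m = 0" if "m \<in> Poly_Mapping.keys f" for m
    using monom_degree_le_total_degree[OF that] by simp
  then have "m = 0" if "m \<in> Poly_Mapping.keys f" for m
    using that by (intro poly_mapping_eqI) (auto simp: monom_degree_UNIV)
  then have "f = Poly_Mapping.single 0 (Poly_Mapping.lookup f 0)"
    by (intro poly_mapping_eqI) (auto simp: lookup_single when_def in_keys_iff)
  then show False using assms unfolding mahler_hypothesis_def by blast
qed

definition hom_component :: "nat \<Rightarrow> 'p::finite cpoly \<Rightarrow> real ^ 'p \<Rightarrow> complex" where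
  "hom_component i f x = (\<Sum>m | m \<in> Poly_Mapping.keys f \<and> monom_degree m = i.
     Poly_Mapping.lookup f m * eval_monom m x)"

lemma homogeneous_hom_component: "homogeneous i (hom_component i f)"
proof -
  have "homogeneous (monom_degree m) (eval_monom m)" for m :: "'a \<Rightarrow>\<^sub>0 nat"
    unfolding homogeneous_def eval_monom_def
    by (auto intro!: continuous_intros simp: power_mult_distrib prod.distrib power_sum monom_degree_UNIV)
  then have "homogeneous i (\<lambda>x. \<Sum>m | m \<in> Poly_Mapping.keys f \<and> monom_degree m = i.
     Poly_Mapping.lookup f m * eval_monom m x)"
    by (intro homogeneous_sum homogeneous_cmult) auto
  then show ?thesis by (simp add: hom_component_def[abs_def])
qed

lemma eval_cpoly_hom_component: "eval_cpoly f x = (\<Sum>i\<le>total_degree f. hom_component i f x)"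
proof -
  have "(\<Sum>i\<le>total_degree f. hom_component i f x) = eval_cpoly f x"
    unfolding hom_component_def eval_cpoly_eq
    by (rule sum.group) (auto simp: monom_degree_le_total_degree)
  then show ?thesis ..
qed

lemma eval_cpoly_top_part: "eval_cpoly (top_part f) x = hom_component (total_degree f) f x"
  by (simp add: top_part_def eval_cpoly_sum eval_cpoly_single hom_component_def)

text \<open>\<open>\<phi>\<close> is the homogenization of \<open>f\<close>, restricted to the closed simplex that compactifies the
  orthant; its boundary values at infinity are those of the top-degree part.\<close>

definition compactifiable :: "nat \<Rightarrow> (real ^ 'p::finite \<Rightarrow> complex) \<Rightarrow> bool" where
  "compactifiable d f \<longleftrightarrow> (\<exists>\<phi>. continuous_on corner_simplex \<phi> \<and> (\<forall>y\<in>corner_simplex. \<phi> y \<noteq> 0) \<and>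
     (\<forall>x\<in>orthant. f x = of_real (1 + coord_sum x) ^ d * \<phi> (compactify x)))"

text \<open>The two nonvanishing conditions of Mahler's hypothesis match the two parts of the
  simplex: that on \<open>f\<close> covers \<open>coord_sum y < 1\<close>, that on the top part
  covers the face at infinity.\<close>

lemma compactifiable_mahler:
  fixes f :: "'p::finite cpoly"
  assumes f: "mahler_hypothesis f"
  shows "compactifiable (total_degree f) (eval_cpoly f)"
proof -
  define d where "d = total_degree f"
  define \<phi> where "\<phi> y = (\<Sum>i\<le>d. of_real (1 - coord_sum y) ^ (d - i) * hom_component i f y)" for y
  \<comment> \<open>The homogenizing variable is \<open>1 - coord_sum y\<close>, and the scale
    \<open>t\<close> is the one that turns it into 1.\<close>
  have eq: "of_real t ^ d * \<phi> y = eval_cpoly f (t *\<^sub>R y)"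
    if y: "y \<in> orthant" and t: "t > 0" "t * (1 - coord_sum y) = 1" for t y
  proof -
    have "of_real t ^ d * \<phi> y = (\<Sum>i\<le>d. of_real t ^ i * hom_component i f y)"
      unfolding \<phi>_def sum_distrib_left
    proof (intro sum.cong refl)
      fix i assume i: "i \<in> {..d}"
      have "(of_real t ^ d :: complex) = of_real t ^ (d - i) * of_real t ^ i"
        using i by (simp flip: power_add)
      then have "of_real t ^ d * (of_real (1 - coord_sum y) ^ (d - i) * hom_component i f y) =
        of_real (t * (1 - coord_sum y)) ^ (d - i) * (of_real t ^ i * hom_component i f y)"
        by (simp only: of_real_mult power_mult_distrib mult_ac)
      then show "of_real t ^ d * (of_real (1 - coord_sum y) ^ (d - i) * hom_component i f y) =
         of_real t ^ i * hom_component i f y"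
        by (simp only: t(2)) simp
    qed
    also have "\<dots> = eval_cpoly f (t *\<^sub>R y)"
      using y t(1) by (simp add: eval_cpoly_hom_component d_def homogeneous_scaleR[OF homogeneous_hom_component])
    finally show ?thesis .
  qed
  have "continuous_on corner_simplex \<phi>"
    unfolding \<phi>_def
    by (intro continuous_intros continuous_on_subset[OF homogeneous_continuous[OF homogeneous_hom_component]]
        corner_simplex_subset)
  moreover have "\<phi> y \<noteq> 0" if y: "y \<in> corner_simplex" for y
  proof (cases "coord_sum y = 1")
    case True
    have "y \<noteq> 0" using True by (auto simp: coord_sum_def)
    \<comment> \<open>All powers of the vanishing homogenizing variable are 0 except the one with
      exponent 0, so only the top component survives.\<close>
    moreover have "\<phi> y = (\<Sum>i\<le>d. if i = d then hom_component i f y else 0)"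
      unfolding \<phi>_def by (intro sum.cong) (use True in auto)
    then have "\<phi> y = hom_component d f y" by simp
    ultimately show ?thesis
      using f y corner_simplex_subset
      by (auto simp: mahler_hypothesis_def eval_cpoly_top_part d_def)
  next
    case False
    define t where "t = 1 / (1 - coord_sum y)"
    have t: "t > 0" "t * (1 - coord_sum y) = 1" using False y by (auto simp: t_def corner_simplex_def)
    have yo: "y \<in> orthant" using y corner_simplex_subset by blast
    have "eval_cpoly f (t *\<^sub>R y) \<noteq> 0"
      using f scaleR_orthant[OF yo, of t] t(1) by (auto simp: mahler_hypothesis_def)
    then show ?thesis using eq[OF yo t] by auto
  qed
  moreover have "eval_cpoly f x = of_real (1 + coord_sum x) ^ d * \<phi> (compactify x)" if x: "x \<in> orthant" for x
  proof -
    have s: "1 + coord_sum x > 0" using coord_sum_nonneg[OF x] by simp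
    have "(1 + coord_sum x) * (1 - coord_sum (compactify x)) = 1"
      using s by (simp add: compactify_def field_simps)
    from eq[OF _ s this] show ?thesis
      using compactify_in[OF x] corner_simplex_subset x by (auto simp: compactify_scaleR)
  qed
  ultimately show ?thesis unfolding compactifiable_def d_def by blast
qed

lemma compactifiable_prod:
  assumes "finite S" "\<And>j. j \<in> S \<Longrightarrow> compactifiable (d j) (f j)"
  shows "compactifiable (\<Sum>j\<in>S. d j) (\<lambda>x. \<Prod>j\<in>S. f j x)"
proof -
  obtain \<phi> where \<phi>: "\<And>j. j \<in> S \<Longrightarrow> continuous_on corner_simplex (\<phi> j)"
    "\<And>j y. j \<in> S \<Longrightarrow> y \<in> corner_simplex \<Longrightarrow> \<phi> j y \<noteq> 0"
    "\<And>j x. j \<in> S \<Longrightarrow> x \<in> orthant \<Longrightarrow> f j x = of_real (1 + coord_sum x) ^ d j * \<phi> j (compactify x)"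
    using assms(2) unfolding compactifiable_def by metis
  show ?thesis unfolding compactifiable_def
    by (rule exI[of _ "\<lambda>y. \<Prod>j\<in>S. \<phi> j y"])
       (use assms(1) \<phi> in \<open>auto intro!: continuous_intros simp: prod.distrib power_sum\<close>)
qed

lemma compactifiable_lower:
  fixes f :: "real ^ 'p::finite \<Rightarrow> complex"
  assumes "compactifiable d f"
  obtains c where "c > 0" "\<And>x. x \<in> orthant \<Longrightarrow> c * (1 + coord_sum x) ^ d \<le> norm (f x)"
proof -
  obtain \<phi> where \<phi>: "continuous_on corner_simplex \<phi>" "\<And>y. y \<in> corner_simplex \<Longrightarrow> \<phi> y \<noteq> 0"
    "\<And>x. x \<in> orthant \<Longrightarrow> f x = of_real (1 + coord_sum x) ^ d * \<phi> (compactify x)"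
    using assms unfolding compactifiable_def by blast
  obtain c where c: "c > 0" "\<And>y. y \<in> corner_simplex \<Longrightarrow> c \<le> norm (\<phi> y)"
    using bounded_below_on_corner_simplex[OF \<phi>(1,2)] by blast
  show thesis
  proof (rule that[OF c(1)])
    fix x :: "real ^ 'p" assume x: "x \<in> orthant"
    have s: "0 \<le> coord_sum x" by (rule coord_sum_nonneg[OF x])
    have "norm (f x) = (1 + coord_sum x) ^ d * norm (\<phi> (compactify x))"
      using s unfolding \<phi>(3)[OF x] norm_mult norm_power norm_of_real by simp
    moreover have "(1 + coord_sum x) ^ d * c \<le> (1 + coord_sum x) ^ d * norm (\<phi> (compactify x))"
      using c(2)[OF compactify_in[OF x]] s by (intro mult_left_mono) auto
    ultimately show "c * (1 + coord_sum x) ^ d \<le> norm (f x)" by (simp add: mult.commute)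
  qed
qed

text \<open>The simplex is contractible, so \<open>\<phi>\<close> has a continuous logarithm there,
  bounded by compactness. Pulled back to the orthant, it differs from
  \<open>L x - d * ln (1 + coord_sum x)\<close> by a continuous function with values in the
  multiples of \<open>2 * pi * \<i>\<close>, hence by a constant.\<close>

lemma compactifiable_log_bounded:
  fixes L :: "real ^ 'p::finite \<Rightarrow> complex"
  assumes f: "compactifiable d f" and L: "continuous_on orthant L" "\<And>x. x \<in> orthant \<Longrightarrow> exp (L x) = f x"
  obtains B where "\<And>x. x \<in> orthant \<Longrightarrow> norm (L x - of_real (real d * ln (1 + coord_sum x))) \<le> B"
proof -
  obtain \<phi> where \<phi>: "continuous_on corner_simplex \<phi>" "\<And>y. y \<in> corner_simplex \<Longrightarrow> \<phi> y \<noteq> 0"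
    "\<And>x. x \<in> orthant \<Longrightarrow> f x = of_real (1 + coord_sum x) ^ d * \<phi> (compactify x)"
    using f unfolding compactifiable_def by blast
  obtain M where M: "continuous_on corner_simplex M" "\<And>y. y \<in> corner_simplex \<Longrightarrow> \<phi> y = exp (M y)"
    using continuous_logarithm_on_contractible[OF \<phi>(1) convex_imp_contractible[OF convex_corner_simplex] \<phi>(2)]
    by blast
  obtain C where C: "\<And>y. y \<in> corner_simplex \<Longrightarrow> norm (M y) \<le> C"
    using bounded_on_corner_simplex[OF M(1)] by blast
  define E where "E x = L x - of_real (real d * ln (1 + coord_sum x)) - M (compactify x)" for x
  have E1: "exp (E x) = 1" if x: "x \<in> orthant" for x :: "real ^ 'p"
  proof -
    have s: "1 + coord_sum x > 0" using coord_sum_nonneg[OF x] by simp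
    have "exp (complex_of_real (real d * ln (1 + coord_sum x))) = of_real ((1 + coord_sum x) ^ d)"
      using s by (simp only: exp_of_real exp_of_nat_mult exp_ln)
    then show ?thesis
      using L(2)[OF x] \<phi>(2,3) M(2) x compactify_in[OF x] s
      by (simp add: E_def exp_diff del: of_real_add of_real_mult)
  qed
  have "continuous_on orthant E"
    unfolding E_def
    using coord_sum_nonneg compactify_in
    by (intro continuous_intros L(1) continuous_on_compose2[OF M(1) continuous_on_compactify]) fastforce+
  moreover have "connected (orthant :: (real ^ 'p) set)"
    by (simp add: convex_connected convex_orthant)
  \<comment> \<open>Distinct values of \<open>E\<close> differ by a nonzero multiple of
    \<open>2 * pi * \<i>\<close>; the gap 1 is enough for discreteness.\<close>
  moreover have "\<exists>e>0. \<forall>y. y \<in> orthant \<and> E y \<noteq> E x \<longrightarrow> e \<le> norm (E y - E x)"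
    if x: "x \<in> orthant" for x
  proof (intro exI[of _ 1] conjI allI impI)
    fix y assume y: "y \<in> orthant \<and> E y \<noteq> E x"
    have "exp (E y - E x) = 1" using E1 x y by (simp add: exp_diff)
    then obtain n :: int where n: "Re (E y - E x) = 0" "Im (E y - E x) = of_int (2 * n) * pi"
      by (auto simp: exp_eq_1)
    have "n \<noteq> 0" using n y by (auto simp: complex_eq_iff)
    then have "1 \<le> \<bar>real_of_int n\<bar>" by linarith
    then have "1 * 1 \<le> \<bar>real_of_int n\<bar> * (2 * pi)" using pi_ge_two by (intro mult_mono) auto
    also have "\<dots> = \<bar>Im (E y - E x)\<bar>" using n(2) by (simp add: abs_mult)
    also have "\<dots> \<le> norm (E y - E x)" by (rule abs_Im_le_cmod)
    finally show "1 \<le> norm (E y - E x)" by simp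
  qed simp
  ultimately have "E constant_on orthant"
    by (intro continuous_discrete_range_constant) auto
  then obtain e where e: "\<And>x. x \<in> orthant \<Longrightarrow> E x = e" unfolding constant_on_def by blast
  show thesis
  proof (rule that)
    fix x :: "real ^ 'p" assume x: "x \<in> orthant"
    have "L x - of_real (real d * ln (1 + coord_sum x)) = e + M (compactify x)"
      using e[OF x] by (simp add: E_def algebra_simps)
    also have "norm \<dots> \<le> norm e + C"
      using C[OF compactify_in[OF x]] norm_triangle_ineq[of e "M (compactify x)"] by linarith
    finally show "norm (L x - of_real (real d * ln (1 + coord_sum x))) \<le> norm e + C" .
  qed
qed

text \<open>A branch that is only assumed continuous is differentiable, because near
  \<open>r\<close> it equals \<open>L r\<close> plus the principal logarithm of
  \<open>f t / f r\<close>, a quotient close to 1.\<close>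

lemma continuous_log_has_vector_derivative:
  fixes L f :: "real \<Rightarrow> complex"
  assumes T: "open T" "r \<in> T" and L: "continuous_on T L" "\<And>t. t \<in> T \<Longrightarrow> exp (L t) = f t"
    and f: "(f has_vector_derivative f') (at r)"
  shows "(L has_vector_derivative f' / f r) (at r)"
proof -
  have fr: "f r \<noteq> 0" using L(2)[OF T(2)] by (metis exp_not_eq_zero)
  have "((\<lambda>t. f t / f r) has_vector_derivative f' / f r) (at r)"
    by (rule has_vector_derivative_divide[OF f])
  moreover have "(Ln has_field_derivative 1) (at (f r / f r))"
    using fr has_field_derivative_Ln[of 1] by simp
  ultimately have "((\<lambda>t. Ln (f t / f r)) has_vector_derivative f' / f r) (at r)"
    using field_vector_diff_chain_at[of "\<lambda>t. f t / f r" "f' / f r" r Ln 1] by (simp add: o_def)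
  then have 1: "((\<lambda>t. L r + Ln (f t / f r)) has_vector_derivative f' / f r) (at r)"
    using has_vector_derivative_add[OF has_vector_derivative_const[of "L r"]] by (metis add_0)
  \<comment> \<open>Continuity keeps the imaginary part of \<open>L t - L r\<close> below 1, hence
    below \<open>pi\<close>, so that \<open>Ln\<close> inverts the exponential there.\<close>
  have "isCont L r" using L(1) T by (simp add: continuous_on_eq_continuous_at)
  then have "eventually (\<lambda>t. dist (L t) (L r) < 1) (at r)"
    unfolding isCont_def by (rule tendstoD) simp
  moreover have "eventually (\<lambda>t. t \<in> T) (at r)"
    using T by (intro eventually_at_in_open') auto
  ultimately have "eventually (\<lambda>t. L r + Ln (f t / f r) = L t) (at r)"
  proof eventually_elim
    case (elim t)
    have "\<bar>Im (L t - L r)\<bar> < 1"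
      using elim(1) abs_Im_le_cmod[of "L t - L r"] by (simp add: dist_norm)
    then have "Ln (exp (L t - L r)) = L t - L r"
      using pi_ge_two by (intro Ln_exp) linarith+
    moreover have "exp (L t - L r) = f t / f r" using L(2) elim(2) T(2) by (simp add: exp_diff)
    ultimately show ?case by simp
  qed
  moreover have "L r + Ln (f r / f r) = L r" using fr by simp
  ultimately show ?thesis
    using 1 unfolding has_vector_derivative_def
    by (auto elim!: has_derivative_transform_eventually)
qed

text \<open>The bound is exclusive: \<open>graded (Suc d)\<close> means degree at most
  \<open>d\<close>, while \<open>graded D\<close> is the form required of the components
  \<open>H i\<close> and \<open>HL i\<close> with \<open>i < D\<close>.\<close>

definition graded :: "nat \<Rightarrow> (real ^ 'p::finite \<Rightarrow> complex) \<Rightarrow> bool" where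
  "graded k g \<longleftrightarrow> (\<exists>c. (\<forall>i<k. homogeneous i (c i)) \<and> (\<forall>x. g x = (\<Sum>i<k. c i x)))"

lemma graded_homogeneous:
  assumes "homogeneous i g" "i < k"
  shows "graded k g"
proof -
  have "homogeneous l (if l = i then g else (\<lambda>_. 0))" for l
    using assms(1) homogeneous_zero by auto
  moreover have "g x = (\<Sum>l<k. (if l = i then g else (\<lambda>_. 0)) x)" for x
  proof -
    have "(\<Sum>l<k. (if l = i then g else (\<lambda>_. 0)) x) = (\<Sum>l<k. if l = i then g x else 0)"
      by (intro sum.cong) auto
    then show ?thesis using assms(2) by simp
  qed
  ultimately show ?thesis unfolding graded_def by (intro exI[of _ "\<lambda>l. if l = i then g else (\<lambda>_. 0)"]) blast
qed

lemma graded_sum: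
  assumes "\<And>j. j \<in> S \<Longrightarrow> graded k (g j)"
  shows "graded k (\<lambda>x. \<Sum>j\<in>S. g j x)"
proof -
  obtain c where c: "\<And>j i. j \<in> S \<Longrightarrow> i < k \<Longrightarrow> homogeneous i (c j i)"
    "\<And>j x. j \<in> S \<Longrightarrow> g j x = (\<Sum>i<k. c j i x)"
  proof -
    have "\<forall>j\<in>S. \<exists>c. (\<forall>i<k. homogeneous i (c i)) \<and> (\<forall>x. g j x = (\<Sum>i<k. c i x))"
      using assms by (simp add: graded_def)
    then show thesis using that unfolding bchoice_iff by blast
  qed
  have "(\<Sum>j\<in>S. g j x) = (\<Sum>i<k. \<Sum>j\<in>S. c j i x)" for x
    by (subst sum.swap) (simp add: c(2))
  then show ?thesis
    unfolding graded_def using c(1) 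
    by (intro exI[of _ "\<lambda>i x. \<Sum>j\<in>S. c j i x"]) (auto intro!: homogeneous_sum)
qed

text \<open>Degrees below \<open>a\<close> and degrees at most \<open>b\<close> add up to degrees
  below \<open>a + b\<close>: one strict bound is enough to keep the product strict.\<close>

lemma graded_mult:
  assumes "graded a g" "graded (Suc b) h"
  shows "graded (a + b) (\<lambda>x. g x * h x)"
proof -
  obtain c where c: "\<And>i. i < a \<Longrightarrow> homogeneous i (c i)" "\<And>x. g x = (\<Sum>i<a. c i x)"
    using assms(1) unfolding graded_def by blast
  obtain e where e: "\<And>i. i < Suc b \<Longrightarrow> homogeneous i (e i)" "\<And>x. h x = (\<Sum>i<Suc b. e i x)"
    using assms(2) unfolding graded_def by blast
  have "graded (a + b) (\<lambda>x. \<Sum>i<a. \<Sum>l<Suc b. c i x * e l x)"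
    by (intro graded_sum graded_homogeneous[OF homogeneous_mult[OF c(1) e(1)]]) auto
  then show ?thesis by (simp add: c(2) e(2) sum_product del: sum.lessThan_Suc)
qed

lemma graded_eval_cpoly: "graded (Suc (total_degree f)) (eval_cpoly f)"
  unfolding graded_def
  by (intro exI[of _ "\<lambda>i. hom_component i f"])
     (simp add: homogeneous_hom_component eval_cpoly_hom_component lessThan_Suc_atMost)

lemma graded_prod:
  assumes "\<And>j. j \<in> S \<Longrightarrow> graded (Suc (d j)) (f j)"
  shows "graded (Suc (\<Sum>j\<in>S. d j)) (\<lambda>x. \<Prod>j\<in>S. f j x)"
  using assms
proof (induction S rule: infinite_finite_induct)
  case (insert j S)
  then show ?case using graded_mult[of "Suc (d j)" "f j" "\<Sum>j\<in>S. d j" "\<lambda>x. \<Prod>j\<in>S. f j x"] by simp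
qed (auto intro!: graded_homogeneous[of 0] simp: homogeneous_def)

text \<open>Euler's identity \<open>E f = d f - h\<close>, where \<open>h = \<Sum>\<^sub>i (d - i) f\<^sub>i\<close> has degree less than \<open>d\<close>.\<close>

definition euler_defect :: "'p::finite cpoly \<Rightarrow> real ^ 'p \<Rightarrow> complex" where
  "euler_defect f x = (\<Sum>i<total_degree f. of_nat (total_degree f - i) * hom_component i f x)"

lemma graded_euler_defect: "graded (total_degree f) (euler_defect f)"
  unfolding graded_def euler_defect_def
  by (intro exI[of _ "\<lambda>i x. of_nat (total_degree f - i) * hom_component i f x"])
     (auto intro!: homogeneous_cmult homogeneous_hom_component)

lemma eval_cpoly_radial_derivative:
  assumes "x \<in> orthant" "r > 0"
  shows "((\<lambda>r. eval_cpoly f (r *\<^sub>R x)) has_vector_derivative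
    (of_nat (total_degree f) * eval_cpoly f (r *\<^sub>R x) - euler_defect f (r *\<^sub>R x)) /\<^sub>R r) (at r)"
proof -
  let ?d = "total_degree f" and ?y = "r *\<^sub>R x"
  have "((\<lambda>r. \<Sum>i\<le>?d. hom_component i f (r *\<^sub>R x)) has_vector_derivative
     (\<Sum>i\<le>?d. (of_nat i * hom_component i f ?y) /\<^sub>R r)) (at r)"
    by (intro has_vector_derivative_sum homogeneous_has_vector_derivative[OF homogeneous_hom_component assms])
  moreover have "(\<Sum>i\<le>?d. of_nat i * hom_component i f ?y)
     = of_nat ?d * eval_cpoly f ?y - euler_defect f ?y"
  proof -
    \<comment> \<open>The top component may be added to the sum since its coefficient is 0.\<close>
    have "euler_defect f ?y = (\<Sum>i\<le>?d. of_nat (?d - i) * hom_component i f ?y)"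
      by (simp add: euler_defect_def flip: lessThan_Suc_atMost)
    also have "\<dots> = (\<Sum>i\<le>?d. of_nat ?d * hom_component i f ?y - of_nat i * hom_component i f ?y)"
      by (intro sum.cong) (auto simp: of_nat_diff left_diff_distrib)
    finally show ?thesis
      by (simp add: sum_subtractf eval_cpoly_hom_component sum_distrib_left)
  qed
  ultimately show ?thesis
    by (simp add: eval_cpoly_hom_component scaleR_sum_right[symmetric])
qed

section \<open>Degree of the product, values of \<open>zeta\<close> at 0, and the product
  formula\<close>

lemma continuous_on_eval_cpoly: "continuous_on A (eval_cpoly f)"
  unfolding eval_cpoly_def by (intro continuous_intros)

text \<open>Growth replaces algebra: the factors force the product to grow with order the sum of the
  degrees throughout the orthant, whereas a polynomial of smaller degree \<open>D'\<close> grows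
  with order at most \<open>D'\<close>.\<close>

lemma total_degree_prod:
  fixes f :: "'i \<Rightarrow> 'p::finite cpoly"
  assumes "finite S" "\<And>j. j \<in> S \<Longrightarrow> mahler_hypothesis (f j)"
  shows "total_degree (\<Prod>j\<in>S. f j) = (\<Sum>j\<in>S. total_degree (f j))"
proof (rule antisym[OF total_degree_prod_le], rule ccontr)
  let ?P = "\<Prod>j\<in>S. f j" and ?D = "\<Sum>j\<in>S. total_degree (f j)"
  define D' where "D' = total_degree ?P"
  assume "\<not> ?D \<le> total_degree ?P"
  then have less: "Suc D' \<le> ?D" by (simp add: D'_def)
  obtain c where c: "c > 0" "\<And>x. x \<in> orthant \<Longrightarrow> c * (1 + coord_sum x) ^ ?D \<le> norm (eval_cpoly ?P x)"
  proof (rule compactifiable_lower)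
    show "compactifiable ?D (eval_cpoly ?P)"
      using compactifiable_prod[of S "\<lambda>j. total_degree (f j)" "\<lambda>j. eval_cpoly (f j)"]
      by (simp add: assms compactifiable_mahler eval_cpoly_prod[abs_def])
  qed blast
  have "\<forall>i. \<exists>C>0. \<forall>x\<in>orthant. norm (hom_component i ?P x) \<le> C * (1 + coord_sum x) ^ i"
    using homogeneous_bound[OF homogeneous_hom_component] by metis
  then obtain C where C: "\<And>i. C i > 0" "\<And>i x. x \<in> orthant \<Longrightarrow> norm (hom_component i ?P x) \<le> C i * (1 + coord_sum x) ^ i"
    by metis
  \<comment> \<open>Chosen so that \<open>c * t\<close> exceeds the sum of the \<open>C i\<close> by
    exactly \<open>c\<close>, which contradicts the two growth bounds.\<close>
  define t where "t = 1 + (\<Sum>i\<le>D'. C i) / c"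
  have "0 \<le> (\<Sum>i\<le>D'. C i)" using C(1) by (intro sum_nonneg) (simp add: less_imp_le)
  then have t: "t \<ge> 1" using c(1) by (simp add: t_def)
  \<comment> \<open>A point on a coordinate axis with \<open>1 + coord_sum x = t\<close>.\<close>
  define x where "x = (t - 1) *\<^sub>R axis (undefined :: 'p) (1 :: real)"
  have x: "x \<in> orthant" using t by (auto simp: x_def orthant_def axis_def)
  have sx: "1 + coord_sum x = t" by (simp add: x_def) (simp add: coord_sum_def axis_def)
  have "c * t ^ Suc D' \<le> c * t ^ ?D"
    using t c(1) less by (intro mult_left_mono power_increasing) auto
  also have "\<dots> \<le> norm (eval_cpoly ?P x)" using c(2)[OF x] by (simp add: sx)
  also have "\<dots> \<le> (\<Sum>i\<le>D'. C i * t ^ i)"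
    unfolding eval_cpoly_hom_component D'_def[symmetric]
    using C(2)[OF x] by (intro order.trans[OF norm_sum] sum_mono) (auto simp: sx)
  also have "\<dots> \<le> (\<Sum>i\<le>D'. C i * t ^ D')"
    using t C(1) by (intro sum_mono mult_left_mono power_increasing) (auto intro: less_imp_le)
  also have "\<dots> = (\<Sum>i\<le>D'. C i) * t ^ D'" by (simp add: sum_distrib_right)
  finally have "(c * t) * t ^ D' \<le> (\<Sum>i\<le>D'. C i) * t ^ D'" by (simp add: mult_ac)
  then have "c * t \<le> (\<Sum>i\<le>D'. C i)" using t by simp
  moreover have "c * t = c + (\<Sum>i\<le>D'. C i)" using c(1) by (simp add: t_def distrib_left)
  ultimately show False using c(1) by simp
qed

text \<open>The polynomial \<open>g\<close> is split into homogeneous components, each continued by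
  \<open>zint_global\<close>; the identity theorem identifies their sum with the function described
  by \<open>zeta\<close>. There \<open>f\<close> enters through the half-plane, hence the assumption
  on its degree.\<close>

lemma (in radial_log) zeta_at_0:
  assumes deg: "total_degree f = d"
  shows "of_nat d * zeta f Lam g 0 = (\<Sum>k\<le>total_degree g.
    - (\<Sum>i<D. zeta_residue (k + CARD('p)) 1 (k + i) (\<lambda>x. hom_component k g x * HL i x)) / of_nat (k + CARD('p)))"
proof -
  let ?K = "total_degree g" and ?w = "\<lambda>k. k + CARD('p)"
  let ?V = "\<lambda>k. - (\<Sum>i<D. zeta_residue (?w k) 1 (k + i) (\<lambda>x. hom_component k g x * HL i x)) / of_nat (?w k) :: complex"
  note hom = homogeneous_hom_component[of _ g]
  have "\<forall>k. \<exists>Z. Z nicely_meromorphic_on UNIV \<and>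
    (\<forall>s. real (?w k) < Re s * real d \<longrightarrow> Z s = zint s 0 (hom_component k g)) \<and>
    (\<lambda>s. of_nat d * Z s) \<midarrow>0\<rightarrow> ?V k"
  proof
    fix k
    show "\<exists>Z. Z nicely_meromorphic_on UNIV \<and>
      (\<forall>s. real (?w k) < Re s * real d \<longrightarrow> Z s = zint s 0 (hom_component k g)) \<and>
      (\<lambda>s. of_nat d * Z s) \<midarrow>0\<rightarrow> ?V k"
      by (rule zint_global[OF hom[of k]]) blast
  qed
  then obtain Z where Z: "\<And>k. Z k nicely_meromorphic_on UNIV"
    "\<And>k s. real (?w k) < Re s * real d \<Longrightarrow> Z k s = zint s 0 (hom_component k g)"
    "\<And>k. (\<lambda>s. of_nat d * Z k s) \<midarrow>0\<rightarrow> ?V k"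
    unfolding choice_iff by blast
  define Y where "Y s = (\<Sum>k\<le>?K. Z k s)" for s
  \<comment> \<open>Poles of the summands may cancel, and then the value of the sum at that point
    need not be the limit; \<open>remove_sings\<close> restores the normalization that
    \<open>zeta\<close> demands.\<close>
  define G where "G = remove_sings Y"
  define U where "U = {s. real (?w ?K) < Re s * real d}"
  have oU: "open U" unfolding U_def by (rule open_half_plane)
  have Ui: "s \<in> U \<longleftrightarrow> real (total_degree g + CARD('p)) / real (total_degree f) < Re s" for s
    using d by (simp add: U_def deg pos_divide_less_eq)
  have "Y meromorphic_on UNIV"
    unfolding Y_def using Z(1) by (auto intro!: meromorphic_intros simp: nicely_meromorphic_on_def)
  then have G: "G nicely_meromorphic_on UNIV" unfolding G_def by (rule remove_sings_nicely_meromorphic)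
  have zU: "zeta_integral Lam g s = (\<Sum>k\<le>?K. zint s 0 (hom_component k g))" if s: "s \<in> U" for s
  proof -
    have "set_integrable lborel orthant (integrand s 0 (hom_component k g))" if "k \<le> ?K" for k
      by (rule set_integrable_integrand[OF hom]) (use s that in \<open>auto simp: U_def weight_def\<close>)
    from set_integral_sum(2)[OF this, of "{..?K}"]
    have "(LINT x:orthant|lborel. \<Sum>k\<le>?K. integrand s 0 (hom_component k g) x) = (\<Sum>k\<le>?K. zint s 0 (hom_component k g))"
      by (simp add: zint_def)
    then show ?thesis
      by (simp add: zeta_integral_def integrand_def eval_cpoly_hom_component sum_distrib_right)
  qed
  have YU: "Y s = zeta_integral Lam g s" if s: "s \<in> U" for s
    unfolding Y_def zU[OF s] by (intro sum.cong refl Z(2)) (use s in \<open>auto simp: U_def\<close>)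
  have GU: "G s = zeta_integral Lam g s" if s: "s \<in> U" for s
  proof -
    have "(\<lambda>s. \<Sum>k\<le>?K. zint s 0 (hom_component k g)) holomorphic_on U"
    proof (intro holomorphic_on_sum)
      fix k assume k: "k \<in> {..?K}"
      show "(\<lambda>s. zint s 0 (hom_component k g)) holomorphic_on U"
        by (rule holomorphic_on_subset[OF zint_holomorphic[OF hom]]) (use k in \<open>auto simp: U_def weight_def\<close>)
    qed
    then have "Y holomorphic_on U"
      by (rule holomorphic_transform) (simp add: YU zU)
    then have "Y analytic_on {s}" using oU s by (auto simp: analytic_at)
    then show ?thesis using YU[OF s] by (simp add: G_def)
  qed
  have "zeta f Lam g = G"
    unfolding zeta_def
  proof (rule the_equality)
    show "G nicely_meromorphic_on UNIV \<and> (\<forall>s. real (total_degree g + CARD('p)) / real (total_degree f) < Re s \<longrightarrow>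
         G s = zeta_integral Lam g s)"
      using G GU Ui by blast
  next
    fix F' assume F': "F' nicely_meromorphic_on UNIV \<and> (\<forall>s. real (total_degree g + CARD('p)) / real (total_degree f) < Re s \<longrightarrow>
         F' s = zeta_integral Lam g s)"
    have "of_real ((real (?w ?K) + 1) / real d) \<in> U" using d by (simp add: U_def)
    then have "U \<noteq> {}" by blast
    moreover have "F' s = G s" if "s \<in> U" for s
      using F' GU[OF that] that Ui by simp
    ultimately show "F' = G"
      using nicely_meromorphic_unique[OF conjunct1[OF F'] G open_UNIV connected_UNIV oU] by blast
  qed
  moreover have "G 0 = (\<Sum>k\<le>?K. ?V k) / of_nat d"
  proof -
    have "(\<lambda>s. (\<Sum>k\<le>?K. of_nat d * Z k s) / of_nat d) \<midarrow>0\<rightarrow> (\<Sum>k\<le>?K. ?V k) / of_nat d"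
      by (intro tendsto_intros Z(3)) (use d in auto)
    moreover have "(\<Sum>k\<le>?K. of_nat d * Z k s) / of_nat d = Y s" for s
      using d by (simp add: Y_def flip: sum_distrib_left)
    ultimately show ?thesis unfolding G_def by (intro remove_sings_eqI) simp
  qed
  ultimately show ?thesis using d by simp
qed

theorem mainTheorem3:
  fixes n :: nat
    and g :: "'p::finite cpoly"
    and f :: "nat \<Rightarrow> 'p cpoly"
    and L :: "nat \<Rightarrow> real ^ 'p \<Rightarrow> complex"
    and Lprod :: "real ^ 'p \<Rightarrow> complex"
  assumes "n \<ge> 1"
    and "\<And>j. j \<in> {1..n} \<Longrightarrow> mahler_hypothesis (f j)"
    and "\<And>j. j \<in> {1..n} \<Longrightarrow> is_log_branch (f j) (L j)"
    and "is_log_branch (\<Prod>j=1..n. f j) Lprod"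
  shows "of_nat (total_degree (\<Prod>j=1..n. f j)) * zeta (\<Prod>j=1..n. f j) Lprod g 0 =
         (\<Sum>j=1..n. of_nat (total_degree (f j)) * zeta (f j) (L j) g 0)"
proof -
  let ?S = "{1..n}"
  let ?P = "\<Prod>j=1..n. f j"
  define d where "d j = total_degree (f j)" for j
  define D where "D = (\<Sum>j\<in>?S. d j)"
  define F where "F = eval_cpoly ?P"
  have degP: "total_degree ?P = D"
    using total_degree_prod[of ?S f] assms(2) by (simp add: D_def d_def)
  have F: "F x = (\<Prod>j\<in>?S. eval_cpoly (f j) x)" for x by (simp add: F_def eval_cpoly_prod)
  have dpos: "d j > 0" if "j \<in> ?S" for j using total_degree_pos[OF assms(2)[OF that]] by (simp add: d_def)
  have dle: "d j \<le> D" if "j \<in> ?S" for j unfolding D_def using that by (intro member_le_sum) auto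
  have Dpos: "D > 0" using dpos[of 1] dle[of 1] assms(1) by auto
  have fnz: "eval_cpoly (f j) x \<noteq> 0" if "j \<in> ?S" "x \<in> orthant" for j x
    using assms(2)[OF that(1)] that(2) by (auto simp: mahler_hypothesis_def)
  have contL: "continuous_on orthant (L j)" and expL: "x \<in> orthant \<Longrightarrow> exp (L j x) = eval_cpoly (f j) x"
    if "j \<in> ?S" for j x
    using assms(3)[OF that] by (auto simp: is_log_branch_def)
  have contLp: "continuous_on orthant Lprod" and expLp: "x \<in> orthant \<Longrightarrow> exp (Lprod x) = F x" for x
    using assms(4) by (auto simp: is_log_branch_def F_def)
  have tame: "compactifiable (d j) (eval_cpoly (f j))" if "j \<in> ?S" for j
    unfolding d_def by (rule compactifiable_mahler[OF assms(2)[OF that]])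
  have tameF: "compactifiable D F"
    using compactifiable_prod[of ?S d "\<lambda>j. eval_cpoly (f j)"] tame by (simp add: D_def F[abs_def])
  have Fnz: "F x \<noteq> 0" if "x \<in> orthant" for x using fnz that by (simp add: F)
  \<comment> \<open>With \<open>e_j\<close> the Euler defect of \<open>f j\<close>, the logarithmic
    derivative is \<open>d_j - e_j / f_j\<close>. Over the denominator \<open>F\<close> the
    numerator becomes \<open>e_j\<close> times the other factors, of degree still below
    \<open>D\<close>; its homogeneous components are the \<open>HL j i\<close>.\<close>
  have "\<forall>j\<in>?S. \<exists>c. (\<forall>i<D. homogeneous i (c i)) \<and>
    (\<forall>x. euler_defect (f j) x * (\<Prod>i\<in>?S - {j}. eval_cpoly (f i) x) = (\<Sum>i<D. c i x))"
  proof
    fix j assume j: "j \<in> ?S"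
    have "graded (Suc (\<Sum>i\<in>?S - {j}. d i)) (\<lambda>x. \<Prod>i\<in>?S - {j}. eval_cpoly (f i) x)"
      unfolding d_def by (intro graded_prod graded_eval_cpoly)
    from graded_mult[OF graded_euler_defect[of "f j"] this]
    have "graded D (\<lambda>x. euler_defect (f j) x * (\<Prod>i\<in>?S - {j}. eval_cpoly (f i) x))"
      using sum.remove[OF finite_atLeastAtMost j, of d] by (simp add: D_def d_def)
    then show "\<exists>c. (\<forall>i<D. homogeneous i (c i)) \<and>
      (\<forall>x. euler_defect (f j) x * (\<Prod>i\<in>?S - {j}. eval_cpoly (f i) x) = (\<Sum>i<D. c i x))"
      unfolding graded_def .
  qed
  then obtain HL where homHL: "\<And>j i. j \<in> ?S \<Longrightarrow> i < D \<Longrightarrow> homogeneous i (HL j i)"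
    and HL: "\<And>j x. j \<in> ?S \<Longrightarrow> euler_defect (f j) x * (\<Prod>i\<in>?S - {j}. eval_cpoly (f i) x) = (\<Sum>i<D. HL j i x)"
    unfolding bchoice_iff by blast
  define H where "H i x = (\<Sum>j\<in>?S. HL j i x)" for i x
  have quotient_rescale: "((a * b - h) /\<^sub>R r) / b = (a - h / b) /\<^sub>R r"
    if "b \<noteq> 0" for a b h :: complex and r :: real
    using that by (simp add: scaleR_conv_of_real field_simps)
  have derivL: "((\<lambda>r. L j (r *\<^sub>R x)) has_vector_derivative
      (of_nat (d j) - (\<Sum>i<D. HL j i (r *\<^sub>R x)) / F (r *\<^sub>R x)) /\<^sub>R r) (at r)"
    if j: "j \<in> ?S" and x: "x \<in> orthant" and r: "r > 0" for j x r
  proof -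
    let ?y = "r *\<^sub>R x"
    have y: "?y \<in> orthant" using x r by (simp add: scaleR_orthant)
    have "((\<lambda>r. L j (r *\<^sub>R x)) has_vector_derivative
      ((of_nat (d j) * eval_cpoly (f j) ?y - euler_defect (f j) ?y) /\<^sub>R r) / eval_cpoly (f j) ?y) (at r)"
      unfolding d_def
    proof (rule continuous_log_has_vector_derivative[of "{0<..}"])
      show "continuous_on {0<..} (\<lambda>r. L j (r *\<^sub>R x))"
        by (intro continuous_on_compose2[OF contL[OF j]] continuous_intros) (auto intro!: scaleR_orthant x)
    qed (use r x eval_cpoly_radial_derivative[OF x r] expL[OF j] scaleR_orthant[OF x] in auto)
    moreover have "F ?y = eval_cpoly (f j) ?y * (\<Prod>i\<in>?S - {j}. eval_cpoly (f i) ?y)"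
      unfolding F using j by (subst prod.remove[of _ j]) auto
    then have "(\<Sum>i<D. HL j i ?y) / F ?y = euler_defect (f j) ?y / eval_cpoly (f j) ?y"
      unfolding HL[OF j, symmetric] using Fnz[OF y] by auto
    moreover have "((of_nat (d j) * eval_cpoly (f j) ?y - euler_defect (f j) ?y) /\<^sub>R r) / eval_cpoly (f j) ?y
      = (of_nat (d j) - euler_defect (f j) ?y / eval_cpoly (f j) ?y) /\<^sub>R r"
      by (rule quotient_rescale[OF fnz[OF j y]])
    ultimately show ?thesis by simp
  qed
  have derivF: "((\<lambda>r. F (r *\<^sub>R x)) has_vector_derivative
      (of_nat D * F (r *\<^sub>R x) - (\<Sum>i<D. H i (r *\<^sub>R x))) /\<^sub>R r) (at r)"
    if x: "x \<in> orthant" and r: "r > 0" for x r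
  proof -
    let ?y = "r *\<^sub>R x"
    have y: "?y \<in> orthant" using x r by (simp add: scaleR_orthant)
    \<comment> \<open>Differentiating \<open>F\<close> as the exponential of the sum of the branches
      makes its Euler defect the sum of the \<open>HL j\<close> at once.\<close>
    have expsum: "exp (\<Sum>j\<in>?S. L j z) = F z" if "z \<in> orthant" for z
      using that expL by (simp add: exp_sum F)
    have "((\<lambda>r. \<Sum>j\<in>?S. L j (r *\<^sub>R x)) has_vector_derivative
       (\<Sum>j\<in>?S. (of_nat (d j) - (\<Sum>i<D. HL j i ?y) / F ?y) /\<^sub>R r)) (at r)"
      by (intro has_vector_derivative_sum derivL x r)
    from field_vector_diff_chain_at[OF this DERIV_exp]
    have "((\<lambda>r. exp (\<Sum>j\<in>?S. L j (r *\<^sub>R x))) has_vector_derivative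
       (\<Sum>j\<in>?S. (of_nat (d j) - (\<Sum>i<D. HL j i ?y) / F ?y) /\<^sub>R r) * F ?y) (at r)"
      unfolding o_def expsum[OF y] .
    also have "(\<Sum>j\<in>?S. (of_nat (d j) - (\<Sum>i<D. HL j i ?y) / F ?y) /\<^sub>R r) * F ?y
      = (of_nat D * F ?y - (\<Sum>i<D. H i ?y)) /\<^sub>R r"
    proof -
      have "(\<Sum>j\<in>?S. of_nat (d j) - (\<Sum>i<D. HL j i ?y) / F ?y) = of_nat D - (\<Sum>i<D. H i ?y) / F ?y"
        unfolding H_def by (subst sum.swap) (simp add: sum_subtractf D_def sum_divide_distrib)
      then show ?thesis
        using Fnz[OF y] by (simp add: scaleR_sum_right[symmetric] left_diff_distrib)
    qed
    finally show ?thesis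
      by (rule has_vector_derivative_transform_within_open[where S = "{0<..}"])
         (use r x expsum in \<open>auto simp: scaleR_orthant\<close>)
  qed
  \<comment> \<open>\<open>Lprod\<close> is an arbitrary branch and may differ from the sum of the
    \<open>L j\<close>, so its derivative is taken from \<open>exp (Lprod x) = F x\<close> and
    \<open>derivF\<close>.\<close>
  have derivLp: "((\<lambda>r. Lprod (r *\<^sub>R x)) has_vector_derivative
      (of_nat D - (\<Sum>i<D. H i (r *\<^sub>R x)) / F (r *\<^sub>R x)) /\<^sub>R r) (at r)"
    if x: "x \<in> orthant" and r: "r > 0" for x r
  proof -
    let ?y = "r *\<^sub>R x"
    have y: "?y \<in> orthant" using x r by (simp add: scaleR_orthant)
    have "((\<lambda>r. Lprod (r *\<^sub>R x)) has_vector_derivative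
      ((of_nat D * F ?y - (\<Sum>i<D. H i ?y)) /\<^sub>R r) / F ?y) (at r)"
    proof (rule continuous_log_has_vector_derivative[of "{0<..}"])
      show "continuous_on {0<..} (\<lambda>r. Lprod (r *\<^sub>R x))"
        by (intro continuous_on_compose2[OF contLp] continuous_intros) (auto intro!: scaleR_orthant x)
    qed (use r x derivF[OF x r] expLp scaleR_orthant[OF x] in auto)
    moreover have "((of_nat D * F ?y - (\<Sum>i<D. H i ?y)) /\<^sub>R r) / F ?y
      = (of_nat D - (\<Sum>i<D. H i ?y) / F ?y) /\<^sub>R r"
      by (rule quotient_rescale[OF Fnz[OF y]])
    ultimately show ?thesis by simp
  qed
  have homH: "homogeneous i (H i)" if "i < D" for i
    unfolding H_def[abs_def] by (intro homogeneous_sum homHL that)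
  obtain c0 where c0: "c0 > 0" "\<And>x. x \<in> orthant \<Longrightarrow> c0 * (1 + coord_sum x) ^ D \<le> norm (F x)"
    using compactifiable_lower[OF tameF] by blast
  \<comment> \<open>Fixed before any logarithm is chosen: the values for the product and for all
    factors are expressed by this one \<open>base.zeta_residue\<close>.\<close>
  interpret base: radial_base F D H c0
    by unfold_locales (use c0 homH derivF in \<open>auto simp: F_def continuous_on_eval_cpoly\<close>)
  obtain B where B: "\<And>x. x \<in> orthant \<Longrightarrow> norm (Lprod x - of_real (real D * ln (1 + coord_sum x))) \<le> B"
    using compactifiable_log_bounded[OF tameF contLp expLp] by blast
  \<comment> \<open>For the product the logarithmic defect coincides with the defect
    \<open>H\<close> of \<open>F\<close>, and the logarithmic degree is \<open>D\<close>.\<close>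
  interpret P: radial_log F D H c0 D Lprod H B
    by unfold_locales (use Dpos contLp B homH derivLp in auto)
  let ?R = "\<lambda>k i h. base.zeta_residue (k + CARD('p)) 1 (k + i) (\<lambda>x. hom_component k g x * h x)"
  have factor: "of_nat (d j) * zeta (f j) (L j) g 0 = (\<Sum>k\<le>total_degree g.
    - (\<Sum>i<D. ?R k i (HL j i)) / of_nat (k + CARD('p)))" if j: "j \<in> ?S" for j
  proof -
    obtain B where B: "\<And>x. x \<in> orthant \<Longrightarrow> norm (L j x - of_real (real (d j) * ln (1 + coord_sum x))) \<le> B"
      using compactifiable_log_bounded[OF tame[OF j] contL[OF j] expL[OF j]] by blast
    interpret radial_log F D H c0 "d j" "L j" "HL j" B
      by unfold_locales (use dpos[OF j] contL[OF j] B homHL[OF j] derivL[OF j] in auto)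
    show ?thesis by (rule zeta_at_0) (simp add: d_def)
  qed
  \<comment> \<open>Linearity in the logarithmic defect: here the value for the product breaks up
    into contributions of the factors.\<close>
  have split: "?R k i (H i) = (\<Sum>j\<in>?S. ?R k i (HL j i))" if "i < D" for k i
  proof -
    have "homogeneous (k + i) (\<lambda>x. hom_component k g x * HL j i x)" if "j \<in> ?S" for j
      by (intro homogeneous_mult homogeneous_hom_component homHL that \<open>i < D\<close>)
    from P.zeta_residue_sum[OF _ this, of ?S] show ?thesis
      by (simp add: H_def sum_distrib_left)
  qed
  have "of_nat D * zeta ?P Lprod g 0 = (\<Sum>k\<le>total_degree g.
    - (\<Sum>i<D. ?R k i (H i)) / of_nat (k + CARD('p)))"
    by (rule P.zeta_at_0[OF degP])
  also have "\<dots> = (\<Sum>k\<le>total_degree g. \<Sum>j\<in>?S. - (\<Sum>i<D. ?R k i (HL j i)) / of_nat (k + CARD('p)))"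
  proof (intro sum.cong refl)
    fix k
    have "(\<Sum>i<D. ?R k i (H i)) = (\<Sum>i<D. \<Sum>j\<in>?S. ?R k i (HL j i))"
      by (intro sum.cong refl split) simp
    also have "\<dots> = (\<Sum>j\<in>?S. \<Sum>i<D. ?R k i (HL j i))" by (rule sum.swap)
    finally show "- (\<Sum>i<D. ?R k i (H i)) / of_nat (k + CARD('p)) =
      (\<Sum>j\<in>?S. - (\<Sum>i<D. ?R k i (HL j i)) / of_nat (k + CARD('p)) :: complex)"
      by (simp only: sum_negf[symmetric] sum_divide_distrib)
  qed
  also have "\<dots> = (\<Sum>j\<in>?S. \<Sum>k\<le>total_degree g. - (\<Sum>i<D. ?R k i (HL j i)) / of_nat (k + CARD('p)))"
    by (rule sum.swap)
  also have "\<dots> = (\<Sum>j\<in>?S. of_nat (d j) * zeta (f j) (L j) g 0)"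
    by (intro sum.cong refl factor[symmetric])
  finally show ?thesis unfolding degP d_def .
qed

end
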